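(* Let $k$ be an arbitrary field, let $C$ be a complete nonsingular curve over $k$ with function field $K=k(C)$, let $N\ge 1$, let $\varphi:\mathbb{P}^N_K\to\mathbb{P}^N_K$ be a morphism of degree at least two, and let $r\ge 1$ be an integer. Then $\varphi$ is isotrivial if and only if the iterate $\varphi^r$ is isotrivial.
   Context: $\varphi^r=\varphi\circ\cdots\circ\varphi$ is the $r$-fold composition. A morphism $\psi:\mathbb{P}^N_K\to\mathbb{P}^N_K$ is isotrivial if there exists a finite extension $K'/K$ such that the induced morphism $\mathbb{P}^N_{K'}\to\mathbb{P}^N_{K'}$ is defined over the algebraic closure $k'$ of $k$ in $K'$. Here "defined over $k'$" means that for some choice of homogeneous coordinates on $\mathbb{P}^N_{K'}$ (i.e. after conjugation by an element of $\mathrm{PGL}_{N+1}(K')$), the morphism is the base change of a morphism $\mathbb{P}^N_{k'}\to\mathbb{P}^N_{k'}$. *)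

theory Defs
  imports
    "HOL-Analysis.Finite_Cartesian_Product"
    "HOL-Algebra.Algebra"
    "HOL-Algebra.Algebraic_Closure_Type"
    "HOL-Library.Poly_Mapping"
begin

section \<open>Complete nonsingular curves\<close>

text \<open>
  An integral separated scheme of finite type over \<open>k\<close> is determined by the set of its local
  rings inside its function field, and it is this set that represents it here (Zariski's models and
  Chevalley's schemata, cf. EGA I, 8). The function field is the whole type \<open>'a\<close>, the base field
  \<open>k\<close> is a subfield of it, and \<open>ring_of_type_algebra\<close> is the field \<open>'a\<close> seen as a record of
  HOL-Algebra.
\<close>

abbreviation induced_ring :: "'a::field set \<Rightarrow> 'a ring" where
  "induced_ring A \<equiv> ring_of_type_algebra\<lparr>carrier := A\<rparr>"

definition localization_at :: "'a::field set \<Rightarrow> 'a set \<Rightarrow> 'a set" where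
  "localization_at A P = {a / s | a s. a \<in> A \<and> s \<in> A - P}"

text \<open>The set of local rings of \<open>Spec A\<close>, for \<open>A\<close> a finitely generated \<open>k\<close>-algebra with fraction
  field \<open>'a\<close>.\<close>

definition affine_model :: "'a::field set \<Rightarrow> 'a set set \<Rightarrow> bool" where
  "affine_model k M \<longleftrightarrow> (\<exists>S A. finite S \<and> A = generate_ring ring_of_type_algebra (k \<union> S) \<and>
     (\<forall>x. \<exists>a\<in>A. \<exists>b\<in>A. b \<noteq> 0 \<and> x = a / b) \<and>
     M = {localization_at A P | P. primeideal P (induced_ring A)})"

definition nonunits :: "'a::field set \<Rightarrow> 'a set" where
  "nonunits R = R - Units (induced_ring R)"

definition valuation_ring_over :: "'a::field set \<Rightarrow> 'a set \<Rightarrow> bool" where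
  "valuation_ring_over k V \<longleftrightarrow> subring V ring_of_type_algebra \<and> k \<subseteq> V \<and>
     (\<forall>x. x \<noteq> 0 \<longrightarrow> x \<in> V \<or> inverse x \<in> V)"

text \<open>For local rings \<open>R \<subseteq> V\<close> the last inclusion says that the maximal ideal of \<open>V\<close> lies over
  that of \<open>R\<close>.\<close>

definition dominates :: "'a::field set \<Rightarrow> 'a set \<Rightarrow> bool" where
  "dominates V R \<longleftrightarrow> R \<subseteq> V \<and> nonunits R \<subseteq> nonunits V"

text \<open>The uniqueness condition is the valuative criterion of separatedness, and
  \<open>complete_model\<close> below is the valuative criterion of properness.\<close>

definition model_over :: "'a::field set \<Rightarrow> 'a set set \<Rightarrow> bool" where
  "model_over k M \<longleftrightarrow> subfield k ring_of_type_algebra \<and>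
     (\<exists>\<A>. finite \<A> \<and> \<A> \<noteq> {} \<and> (\<forall>U\<in>\<A>. affine_model k U) \<and> M = \<Union>\<A>) \<and>
     (\<forall>V. valuation_ring_over k V \<longrightarrow>
       (\<forall>R\<in>M. \<forall>R'\<in>M. dominates V R \<and> dominates V R' \<longrightarrow> R = R'))"

definition complete_model :: "'a::field set \<Rightarrow> 'a set set \<Rightarrow> bool" where
  "complete_model k M \<longleftrightarrow> model_over k M \<and>
     (\<forall>V. valuation_ring_over k V \<longrightarrow> (\<exists>R\<in>M. dominates V R))"

definition prime_chain :: "'a::field set \<Rightarrow> nat \<Rightarrow> (nat \<Rightarrow> 'a set) \<Rightarrow> bool" where
  "prime_chain R n P \<longleftrightarrow> (\<forall>i\<le>n. primeideal (P i) (induced_ring R)) \<and> (\<forall>i<n. P i \<subset> P (Suc i))"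

definition has_krull_dim :: "'a::field set \<Rightarrow> nat \<Rightarrow> bool" where
  "has_krull_dim R n \<longleftrightarrow> (\<exists>P. prime_chain R n P) \<and> \<not> (\<exists>P. prime_chain R (Suc n) P)"

definition regular_local_ring :: "'a::field set \<Rightarrow> bool" where
  "regular_local_ring R \<longleftrightarrow> noetherian_ring (induced_ring R) \<and>
     ideal (nonunits R) (induced_ring R) \<and>
     (\<exists>n S. has_krull_dim R n \<and> S \<subseteq> R \<and> finite S \<and> card S = n \<and>
        nonunits R = genideal (induced_ring R) S)"

definition complete_nonsingular_curve :: "'a::field set \<Rightarrow> 'a set set \<Rightarrow> bool" where
  "complete_nonsingular_curve k C \<longleftrightarrow> complete_model k C \<and>
     (\<forall>R\<in>C. \<exists>n\<le>1. has_krull_dim R n) \<and> (\<exists>R\<in>C. has_krull_dim R 1) \<and>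
     (\<forall>R\<in>C. regular_local_ring R)"


section \<open>Endomorphisms of projective space\<close>

text \<open>Polynomials in indeterminates indexed by \<open>'n\<close>: finitely supported maps from exponent vectors
  to coefficients.\<close>

type_synonym ('n, 'a) mpoly = "('n \<Rightarrow>\<^sub>0 nat) \<Rightarrow>\<^sub>0 'a"

text \<open>Substitution of \<open>x\<close> for the indeterminates, with coefficients sent along \<open>h\<close>.\<close>

definition eval_mpoly ::
  "('a::zero \<Rightarrow> 'c::comm_ring_1) \<Rightarrow> ('n::finite \<Rightarrow> 'c) \<Rightarrow> ('n, 'a) mpoly \<Rightarrow> 'c" where
  "eval_mpoly h x p =
     (\<Sum>m\<in>Poly_Mapping.keys p. h (Poly_Mapping.lookup p m) * (\<Prod>i\<in>UNIV. x i ^ Poly_Mapping.lookup m i))"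

definition const_mpoly :: "'a::zero \<Rightarrow> ('n, 'a) mpoly" where
  "const_mpoly c = Poly_Mapping.single 0 c"

definition var_mpoly :: "'n \<Rightarrow> ('n, 'a::zero_neq_one) mpoly" where
  "var_mpoly i = Poly_Mapping.single (Poly_Mapping.single i 1) 1"

definition homogeneous :: "nat \<Rightarrow> ('n::finite, 'a::zero) mpoly \<Rightarrow> bool" where
  "homogeneous d p \<longleftrightarrow> (\<forall>m\<in>Poly_Mapping.keys p. (\<Sum>i\<in>UNIV. Poly_Mapping.lookup m i) = d)"

text \<open>\<open>F\<close> represents a morphism of degree \<open>d\<close> over the subfield \<open>L\<close> from the projective space with
  homogeneous coordinates indexed by \<open>'n\<close> (so of dimension \<open>CARD('n) - 1\<close>) to itself: forms of
  degree \<open>d\<close> over \<open>L\<close> with no common zero in projective space over an algebraically closed extension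
  of \<open>L\<close>. Two such tuples represent the same morphism iff they are proportional.\<close>

definition proj_morphism ::
  "'b::alg_closed_field set \<Rightarrow> nat \<Rightarrow> ('n::finite \<Rightarrow> ('n, 'b) mpoly) \<Rightarrow> bool" where
  "proj_morphism L d F \<longleftrightarrow>
     (\<forall>i. homogeneous d (F i) \<and> (\<forall>m. Poly_Mapping.lookup (F i) m \<in> L)) \<and>
     (\<forall>x. (\<forall>i. eval_mpoly id x (F i) = 0) \<longrightarrow> (\<forall>i. x i = 0))"

definition same_morphism ::
  "'b::field set \<Rightarrow> ('n \<Rightarrow> ('n, 'b) mpoly) \<Rightarrow> ('n \<Rightarrow> ('n, 'b) mpoly) \<Rightarrow> bool" where
  "same_morphism L F G \<longleftrightarrow> (\<exists>c\<in>L. c \<noteq> 0 \<and> (\<forall>i. F i = const_mpoly c * G i))"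

definition mor_comp ::
  "('n::finite \<Rightarrow> ('n, 'a::comm_ring_1) mpoly) \<Rightarrow> ('n \<Rightarrow> ('n, 'a) mpoly) \<Rightarrow> 'n \<Rightarrow> ('n, 'a) mpoly"
where
  "mor_comp F G = (\<lambda>i. eval_mpoly const_mpoly G (F i))"

definition mor_iterate ::
  "('n::finite \<Rightarrow> ('n, 'a::comm_ring_1) mpoly) \<Rightarrow> nat \<Rightarrow> 'n \<Rightarrow> ('n, 'a) mpoly" where
  "mor_iterate F r = (mor_comp F ^^ r) var_mpoly"

definition linear_mor :: "'b::comm_ring_1^'n::finite^'n \<Rightarrow> 'n \<Rightarrow> ('n, 'b) mpoly" where
  "linear_mor A = (\<lambda>i. \<Sum>j\<in>UNIV. const_mpoly (A $ i $ j) * var_mpoly j)"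

definition mor_conj ::
  "'b::comm_ring_1^'n::finite^'n \<Rightarrow> ('n \<Rightarrow> ('n, 'b) mpoly) \<Rightarrow> 'n \<Rightarrow> ('n, 'b) mpoly" where
  "mor_conj A F = mor_comp (linear_mor (matrix_inv A)) (mor_comp F (linear_mor A))"

definition base_change ::
  "('n \<Rightarrow> ('n, 'a::field) mpoly) \<Rightarrow> 'n \<Rightarrow> ('n, 'a alg_closure) mpoly" where
  "base_change F = (\<lambda>i. Poly_Mapping.map to_ac (F i))"


section \<open>Isotriviality\<close>

text \<open>Every finite extension of the field \<open>'a\<close> embeds over \<open>'a\<close> into \<open>'a alg_closure\<close>.\<close>

definition finite_ext :: "'a::field alg_closure set \<Rightarrow> bool" where
  "finite_ext K' \<longleftrightarrow> subfield K' ring_of_type_algebra \<and> range to_ac \<subseteq> K' \<and>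
     ring.finite_dimension ring_of_type_algebra (range to_ac) K'"

definition alg_closure_in :: "'a::field set \<Rightarrow> 'a alg_closure set \<Rightarrow> 'a alg_closure set" where
  "alg_closure_in k K' = {x \<in> K'. ring.algebraic ring_of_type_algebra (to_ac ` k) x}"

definition isotrivial :: "'a::field set \<Rightarrow> ('n::finite \<Rightarrow> ('n, 'a) mpoly) \<Rightarrow> bool" where
  "isotrivial k F \<longleftrightarrow>
     (\<exists>K' A G d. finite_ext K' \<and> (\<forall>i j. A $ i $ j \<in> K') \<and> invertible A \<and>
        proj_morphism (alg_closure_in k K') d G \<and>
        same_morphism K' (mor_conj A (base_change F)) G)"

end

theory Submission
  imports Defs
begin

text \<open>
  Write \<open>\<Omega>\<close> for the algebraic closure of \<open>K\<close>. An iterate of an isotrivial morphism is isotrivial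
  because composition commutes with conjugation and does not leave the field of definition; this
  is \<open>isotrivial_iterate\<close>.

  Conversely, let the conjugate of \<open>\<phi>\<^sup>r\<close> by \<open>A\<close> be a constant multiple of \<open>\<Psi>\<close>, where \<open>\<Psi>\<close> has
  coefficients algebraic over \<open>k\<close>. Multiplying the conjugate of \<open>\<phi>\<close> by \<open>A\<close> with a suitable element of
  \<open>\<Omega>\<close> gives a lift \<open>\<Phi>\<close> with \<open>\<Phi>\<^sup>r = \<Psi>\<close> as tuples of polynomials, so that \<open>\<Phi>\<close> and \<open>\<Psi>\<close> commute
  exactly. Let \<open>L\<close> be the field of elements of \<open>\<Omega>\<close> algebraic over \<open>k\<close>. The claim, which is
  \<open>commuting_coefficients\<close> together with \<open>algebraic_if_finitely_generated\<close>, is that all coefficients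
  of \<open>\<Phi>\<close> already lie in \<open>L\<close>. So \<open>\<phi>\<close> is isotrivial by the same change of coordinates, after adjoining
  to the given finite extension the scaling factor and the coefficients of \<open>\<Phi>\<close>.

  The claim is proved as follows. The forms \<open>\<Psi>\<^sub>j\<close>, of degree \<open>D \<ge> 2\<close>, have no common zero except
  the origin, so by the Nullstellensatz \<open>x\<^sub>i\<^sup>M = \<Sum>\<^sub>j H\<^sub>i\<^sub>j(x) \<Psi>\<^sub>j(x)\<close> with forms \<open>H\<^sub>i\<^sub>j\<close>
  of degree \<open>M - D\<close> over \<open>L\<close> (\<open>nullstellensatz_over_subfield\<close>). Let \<open>S\<close> be the set of all values
  \<open>\<Phi>\<^sub>i(x)\<close> at points \<open>x\<close> with coordinates in \<open>L\<close>. For \<open>w = \<Phi>(x)\<close> we have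
  \<open>\<Psi>\<^sub>j(w) = \<Psi>\<^sub>j(\<Phi>(x)) = \<Phi>\<^sub>j(\<Psi>(x)) \<in> S\<close>, because \<open>\<Psi>(x)\<close> has coordinates in \<open>L\<close> again. Hence
  \<open>w\<^sub>i\<^sup>M\<close> is an \<open>L\<close>-linear combination of products of at most \<open>M - D + 1 < M\<close> elements of \<open>S\<close>. As \<open>L\<close> is
  infinite, the coefficients of \<open>\<Phi>\<close> are \<open>L\<close>-linear combinations of its values
  (\<open>coefficients_in_subspace\<close>), so finitely many elements of \<open>S\<close> span all of \<open>S\<close> over \<open>L\<close>. Replacing
  \<open>M\<close>-th powers of these generators by terms of lower degree shows that the ring they generate is
  spanned over \<open>L\<close> by monomials of bounded degree (\<open>filtration_stabilises\<close>). It is therefore a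
  finite-dimensional \<open>L\<close>-algebra, all of its elements are algebraic over \<open>L\<close>, and \<open>L\<close> contains them.

  The Nullstellensatz is proved by elimination of one indeterminate at a time.
\<close>

section \<open>Evaluation of polynomials\<close>

text \<open>Homomorphisms of commutative rings with unit.\<close>

definition coeff_hom :: "('a::comm_ring_1 \<Rightarrow> 'c::comm_ring_1) \<Rightarrow> bool" where
  "coeff_hom h \<longleftrightarrow> h 0 = 0 \<and> h 1 = 1 \<and> (\<forall>a b. h (a + b) = h a + h b) \<and> (\<forall>a b. h (a * b) = h a * h b)"

lemma coeff_homD:
  assumes "coeff_hom h"
  shows "h 0 = 0" "h 1 = 1" "h (a + b) = h a + h b" "h (a * b) = h a * h b"
  using assms by (auto simp: coeff_hom_def)

lemma coeff_hom_uminus: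
  assumes "coeff_hom h" shows "h (- a) = - h a"
  using coeff_homD(3)[OF assms, of a "- a"] coeff_homD(1)[OF assms] by (simp add: eq_neg_iff_add_eq_0 add.commute)

lemma coeff_hom_sum:
  assumes "coeff_hom h" shows "h (sum f A) = (\<Sum>x\<in>A. h (f x))"
  by (induction A rule: infinite_finite_induct) (auto simp: coeff_homD[OF assms])

lemma coeff_hom_prod:
  assumes "coeff_hom h" shows "h (prod f A) = (\<Prod>x\<in>A. h (f x))"
  by (induction A rule: infinite_finite_induct) (auto simp: coeff_homD[OF assms])

lemma coeff_hom_power:
  assumes "coeff_hom h" shows "h (x ^ n) = h x ^ n"
  by (induction n) (auto simp: coeff_homD[OF assms])

lemma coeff_hom_id [simp]: "coeff_hom id"
  by (simp add: coeff_hom_def)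

lemma coeff_hom_const [simp]: "coeff_hom (const_mpoly :: 'a::comm_ring_1 \<Rightarrow> ('n, 'a) mpoly)"
  by (auto simp: coeff_hom_def const_mpoly_def single_add mult_single)

lemma coeff_hom_to_ac [simp]: "coeff_hom to_ac"
  by (simp add: coeff_hom_def)

lemma coeff_hom_comp: "coeff_hom h \<Longrightarrow> coeff_hom g \<Longrightarrow> coeff_hom (h \<circ> g)"
  by (simp add: coeff_hom_def)

lemma const_mpoly_0 [simp]: "const_mpoly 0 = 0"
  and const_mpoly_1 [simp]: "const_mpoly 1 = 1"
  by (simp_all add: const_mpoly_def)

lemma const_mpoly_mult: "const_mpoly (a * b :: 'a::comm_ring_1) = const_mpoly a * const_mpoly b"
  by (rule coeff_homD(4)[OF coeff_hom_const])

lemma sum_single_lookup: "(\<Sum>m\<in>Poly_Mapping.keys p. Poly_Mapping.single m (Poly_Mapping.lookup p m)) = p"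
  by (rule poly_mapping_eqI) (auto simp: lookup_sum lookup_single when_def in_keys_iff)

lemma eval_mpoly_superset:
  assumes "h 0 = 0" "finite A" "Poly_Mapping.keys p \<subseteq> A"
  shows "eval_mpoly h x p =
    (\<Sum>m\<in>A. h (Poly_Mapping.lookup p m) * (\<Prod>i\<in>UNIV. x i ^ Poly_Mapping.lookup m i))"
  unfolding eval_mpoly_def using assms by (intro sum.mono_neutral_left) (auto simp: in_keys_iff)

lemma eval_mpoly_0 [simp]: "eval_mpoly h x 0 = 0"
  by (simp add: eval_mpoly_def)

lemma eval_mpoly_add:
  assumes "coeff_hom h"
  shows "eval_mpoly h x (p + q) = eval_mpoly h x p + eval_mpoly h x q"
proof -
  let ?A = "Poly_Mapping.keys p \<union> Poly_Mapping.keys q"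
  have "Poly_Mapping.keys (p + q) \<subseteq> ?A" by (rule keys_add)
  thus ?thesis
    using coeff_homD[OF assms]
    by (simp add: eval_mpoly_superset[of h ?A] lookup_add distrib_right sum.distrib)
qed

lemma eval_mpoly_sum:
  assumes "coeff_hom h"
  shows "eval_mpoly h x (sum f A) = (\<Sum>a\<in>A. eval_mpoly h x (f a))"
  by (induction A rule: infinite_finite_induct) (auto simp: eval_mpoly_add[OF assms])

lemma eval_mpoly_single:
  assumes "coeff_hom h"
  shows "eval_mpoly h x (Poly_Mapping.single m c) = h c * (\<Prod>i\<in>UNIV. x i ^ Poly_Mapping.lookup m i)"
  using coeff_homD[OF assms] by (simp add: eval_mpoly_superset[of h "{m}"])

lemma mult_eq_sum_single:
  fixes p :: "('n::finite, 'b::comm_ring_1) mpoly"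
  shows "p * q = (\<Sum>m\<in>Poly_Mapping.keys p. \<Sum>m'\<in>Poly_Mapping.keys q.
      Poly_Mapping.single (m + m') (Poly_Mapping.lookup p m * Poly_Mapping.lookup q m'))"
  by (subst (1 2) sum_single_lookup[symmetric]) (simp add: sum_product mult_single)

lemma eval_mpoly_mult:
  assumes h: "coeff_hom h"
  shows "eval_mpoly h x (p * q) = eval_mpoly h x p * eval_mpoly h x q"
proof -
  have "eval_mpoly h x (p * q) = (\<Sum>m\<in>Poly_Mapping.keys p. \<Sum>m'\<in>Poly_Mapping.keys q.
      h (Poly_Mapping.lookup p m) * (\<Prod>i\<in>UNIV. x i ^ Poly_Mapping.lookup m i) *
      (h (Poly_Mapping.lookup q m') * (\<Prod>i\<in>UNIV. x i ^ Poly_Mapping.lookup m' i)))"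
    by (simp add: mult_eq_sum_single eval_mpoly_sum[OF h] eval_mpoly_single[OF h] lookup_add power_add
        prod.distrib coeff_homD(4)[OF h] mult_ac)
  thus ?thesis by (simp add: eval_mpoly_def sum_product)
qed

lemma coeff_hom_eval [simp]: 
  fixes x :: "'n::finite \<Rightarrow> 'c::comm_ring_1"
  assumes "coeff_hom h" shows "coeff_hom (eval_mpoly h x)"
proof -
  have "eval_mpoly h x 1 = 1"
    using eval_mpoly_single[OF assms, of x 0 1] coeff_homD[OF assms] by simp
  thus ?thesis
    by (auto simp: coeff_hom_def eval_mpoly_add[OF assms] eval_mpoly_mult[OF assms])
qed

lemma eval_mpoly_const [simp]: "coeff_hom h \<Longrightarrow> eval_mpoly h x (const_mpoly c) = h c"
  by (simp add: const_mpoly_def eval_mpoly_single)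

lemma prod_power_single:
  "(\<Prod>j\<in>UNIV. x j ^ Poly_Mapping.lookup (Poly_Mapping.single i n) j) = (x (i::'n::finite) :: 'c::comm_ring_1) ^ n"
proof -
  have "(\<Prod>j\<in>UNIV. x j ^ Poly_Mapping.lookup (Poly_Mapping.single i n) j)
      = (\<Prod>j\<in>UNIV. if j = i then x j ^ n else 1)"
    by (intro prod.cong) (auto simp: lookup_single when_def)
  thus ?thesis by simp
qed

lemma eval_mpoly_var [simp]: "coeff_hom h \<Longrightarrow> eval_mpoly h x (var_mpoly i) = x i"
  using coeff_homD(2) by (force simp: var_mpoly_def eval_mpoly_single prod_power_single)

lemma var_mpoly_power:
  "var_mpoly i ^ k = Poly_Mapping.single (Poly_Mapping.single i k) (1::'a::comm_ring_1)"
  by (induction k) (auto simp: var_mpoly_def mult_single single_add[symmetric])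

lemma single_eq_prod_var:
  "Poly_Mapping.single m (c::'a::comm_ring_1) = const_mpoly c * (\<Prod>i\<in>(UNIV::'n::finite set). var_mpoly i ^ Poly_Mapping.lookup m i)"
proof -
  have "(\<Prod>i\<in>A. var_mpoly i ^ Poly_Mapping.lookup m i)
      = Poly_Mapping.single (\<Sum>i\<in>A. Poly_Mapping.single i (Poly_Mapping.lookup m i)) (1::'a)"
    if "finite A" for A :: "'n set"
    using that by (induction A rule: finite_induct) (auto simp: var_mpoly_power mult_single)
  moreover have "(\<Sum>i\<in>UNIV. Poly_Mapping.single i (Poly_Mapping.lookup m i)) = m"
    by (rule poly_mapping_eqI) (auto simp: lookup_sum lookup_single when_def)
  ultimately show ?thesis
    by (simp add: const_mpoly_def mult_single)
qed

lemma eval_mpoly_const_var: "eval_mpoly const_mpoly var_mpoly p = p"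
  by (simp add: eval_mpoly_def single_eq_prod_var[symmetric] sum_single_lookup)

text \<open>Every ring homomorphism commutes with substitution; all rules for iterated substitution follow
  from this.\<close>

lemma hom_eval_mpoly:
  assumes "coeff_hom g"
  shows "g (eval_mpoly h x p) = eval_mpoly (g \<circ> h) (\<lambda>i. g (x i)) p"
  by (simp add: eval_mpoly_def coeff_hom_sum[OF assms] coeff_hom_prod[OF assms]
      coeff_hom_power[OF assms] coeff_homD(4)[OF assms])

lemma eval_eval_const:
  assumes "coeff_hom h"
  shows "eval_mpoly h x (eval_mpoly const_mpoly G p) = eval_mpoly h (\<lambda>j. eval_mpoly h x (G j)) p"
proof -
  have "eval_mpoly h x \<circ> const_mpoly = h" using assms by auto
  thus ?thesis using hom_eval_mpoly[OF coeff_hom_eval[OF assms], of x const_mpoly G p] by simp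
qed

lemma eval_mor_comp:
  assumes "coeff_hom h"
  shows "eval_mpoly h x (mor_comp F G i) = eval_mpoly h (\<lambda>j. eval_mpoly h x (G j)) (F i)"
  by (simp add: mor_comp_def eval_eval_const[OF assms])

lemma mor_comp_assoc: "mor_comp (mor_comp F G) H = mor_comp F (mor_comp G H)"
  unfolding mor_comp_def by (simp add: eval_eval_const)

lemma mor_comp_var_right [simp]: "mor_comp F var_mpoly = F"
  by (simp add: mor_comp_def eval_mpoly_const_var)

lemma mor_comp_var_left [simp]: "mor_comp var_mpoly F = F"
  by (simp add: mor_comp_def)

lemma mor_iterate_0 [simp]: "mor_iterate F 0 = var_mpoly"
  and mor_iterate_Suc: "mor_iterate F (Suc r) = mor_comp F (mor_iterate F r)"
  by (simp_all add: mor_iterate_def)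

lemma mor_iterate_Suc': "mor_iterate F (Suc r) = mor_comp (mor_iterate F r) F"
proof (induction r)
  case 0 show ?case by (simp add: mor_iterate_Suc)
next
  case (Suc r)
  thus ?case by (metis mor_iterate_Suc mor_comp_assoc)
qed

lemma mor_iterate_commute: "mor_comp F (mor_iterate F r) = mor_comp (mor_iterate F r) F"
  using mor_iterate_Suc mor_iterate_Suc' by metis

section \<open>Linear changes of coordinates and base change\<close>

lemma linear_comp: "mor_comp (linear_mor A) (linear_mor B) = linear_mor (A ** B)"
proof
  fix i
  have "mor_comp (linear_mor A) (linear_mor B) i
      = (\<Sum>j\<in>UNIV. const_mpoly (A $ i $ j) * (\<Sum>k\<in>UNIV. const_mpoly (B $ j $ k) * var_mpoly k))"
    by (simp add: mor_comp_def linear_mor_def eval_mpoly_sum eval_mpoly_mult)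
  also have "\<dots> = (\<Sum>k\<in>UNIV. \<Sum>j\<in>UNIV. const_mpoly (A $ i $ j * B $ j $ k) * var_mpoly k)"
    by (subst sum.swap) (simp add: sum_distrib_left const_mpoly_mult mult_ac)
  also have "\<dots> = linear_mor (A ** B) i"
    by (simp add: linear_mor_def matrix_matrix_mult_def coeff_hom_sum[OF coeff_hom_const] sum_distrib_right)
  finally show "mor_comp (linear_mor A) (linear_mor B) i = linear_mor (A ** B) i" .
qed

lemma linear_id: "linear_mor (mat 1) = var_mpoly"
proof
  fix i :: "'n::finite"
  have "linear_mor (mat 1) i = (\<Sum>j\<in>UNIV. if j = i then var_mpoly j else 0)"
    unfolding linear_mor_def by (intro sum.cong) (auto simp: mat_def)
  thus "linear_mor (mat 1) i = var_mpoly i" by simp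
qed

lemma matrix_inv_both:
  assumes "invertible A"
  shows "A ** matrix_inv A = mat 1" "matrix_inv A ** A = mat 1"
  using assms unfolding invertible_def matrix_inv_def by (metis (mono_tags, lifting) someI_ex)+

lemma linear_matrix_inv:
  assumes "invertible A"
  shows "mor_comp (linear_mor A) (linear_mor (matrix_inv A)) = var_mpoly"
    and "mor_comp (linear_mor (matrix_inv A)) (linear_mor A) = var_mpoly"
  using matrix_inv_both[OF assms] by (simp_all add: linear_comp linear_id)

lemma mor_conj_comp:
  assumes "invertible A"
  shows "mor_conj A (mor_comp F G) = mor_comp (mor_conj A F) (mor_conj A G)"
proof -
  have "mor_comp (mor_conj A F) (mor_conj A G) = mor_comp (linear_mor (matrix_inv A)) (mor_comp F
     (mor_comp (mor_comp (linear_mor A) (linear_mor (matrix_inv A))) (mor_comp G (linear_mor A))))"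
    by (simp only: mor_conj_def mor_comp_assoc)
  thus ?thesis by (simp add: linear_matrix_inv[OF assms] mor_conj_def mor_comp_assoc)
qed

lemma mor_conj_iterate:
  assumes "invertible A"
  shows "mor_conj A (mor_iterate F r) = mor_iterate (mor_conj A F) r"
proof (induction r)
  case 0
  show ?case by (simp add: mor_conj_def linear_matrix_inv[OF assms])
next
  case (Suc r)
  thus ?case by (simp add: mor_iterate_Suc mor_conj_comp[OF assms])
qed

lemma lookup_base_change: "Poly_Mapping.lookup (base_change F i) m = to_ac (Poly_Mapping.lookup (F i) m)"
  by (simp add: base_change_def map.rep_eq when_def)

lemma base_change_eq_eval: "base_change F i = eval_mpoly (const_mpoly \<circ> to_ac) var_mpoly (F i)"
proof -
  have "Poly_Mapping.keys (base_change F i) = Poly_Mapping.keys (F i)"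
    by (auto simp: in_keys_iff lookup_base_change)
  thus ?thesis
    using eval_mpoly_const_var[of "base_change F i"]
    by (simp add: eval_mpoly_def lookup_base_change)
qed

lemma base_change_comp: "base_change (mor_comp F G) = mor_comp (base_change F) (base_change G)"
proof
  fix i
  let ?h = "const_mpoly \<circ> to_ac" and ?e = "eval_mpoly const_mpoly (base_change G)"
  have e: "coeff_hom ?e" by simp
  have h: "coeff_hom ?h" by (intro coeff_hom_comp) auto
  have *: "?e \<circ> ?h = ?h" by auto
  have "base_change (mor_comp F G) i = eval_mpoly ?h (\<lambda>j. base_change G j) (F i)"
    unfolding base_change_eq_eval[of "mor_comp F G"] eval_mor_comp[OF h] base_change_eq_eval ..
  also have "\<dots> = ?e (eval_mpoly ?h var_mpoly (F i))"
    using hom_eval_mpoly[OF e, of ?h var_mpoly "F i"] * by simp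
  also have "\<dots> = mor_comp (base_change F) (base_change G) i"
    by (simp add: mor_comp_def base_change_eq_eval)
  finally show "base_change (mor_comp F G) i = mor_comp (base_change F) (base_change G) i" .
qed

lemma base_change_iterate: "base_change (mor_iterate F r) = mor_iterate (base_change F) r"
proof (induction r)
  case 0
  have "coeff_hom (const_mpoly \<circ> to_ac :: 'b \<Rightarrow> ('a, 'b alg_closure) mpoly)"
    by (intro coeff_hom_comp) auto
  thus ?case by (auto simp: base_change_eq_eval)
next
  case (Suc r)
  thus ?case by (simp add: mor_iterate_Suc base_change_comp)
qed

section \<open>Homogeneous polynomials\<close>

text \<open>The total degree of an exponent vector.\<close>

definition mdeg :: "('n::finite \<Rightarrow>\<^sub>0 nat) \<Rightarrow> nat" where
  "mdeg m = (\<Sum>i\<in>UNIV. Poly_Mapping.lookup m i)"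

lemma mdeg_add: "mdeg (m + m') = mdeg m + mdeg m'"
  by (simp add: mdeg_def lookup_add sum.distrib)

lemma mdeg_0 [simp]: "mdeg 0 = 0" by (simp add: mdeg_def)

lemma mdeg_single [simp]: "mdeg (Poly_Mapping.single i k) = k"
  by (simp add: mdeg_def lookup_single when_def)

lemma homogeneous_altdef: "homogeneous d p \<longleftrightarrow> (\<forall>m\<in>Poly_Mapping.keys p. mdeg m = d)"
  by (simp add: homogeneous_def mdeg_def)

lemma homogeneous_0 [simp]: "homogeneous d 0" by (simp add: homogeneous_def)

lemma homogeneous_add: "homogeneous d p \<Longrightarrow> homogeneous d q \<Longrightarrow> homogeneous d (p + q)"
  using keys_add[of p q] unfolding homogeneous_def by blast

lemma homogeneous_sum: "(\<And>a. a \<in> A \<Longrightarrow> homogeneous d (f a)) \<Longrightarrow> homogeneous d (sum f A)"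
  by (induction A rule: infinite_finite_induct) (auto intro: homogeneous_add)

lemma homogeneous_mult: "homogeneous d p \<Longrightarrow> homogeneous e q \<Longrightarrow> homogeneous (d + e) (p * q)"
  using keys_mult[of p q] unfolding homogeneous_altdef by (fastforce simp: mdeg_add)

lemma homogeneous_const [simp]: "homogeneous 0 (const_mpoly c)"
  by (simp add: homogeneous_altdef const_mpoly_def)

lemma homogeneous_const_mult: "homogeneous d p \<Longrightarrow> homogeneous d (const_mpoly c * p)"
  using homogeneous_mult[OF homogeneous_const] by force

lemma homogeneous_var [simp]: "homogeneous 1 (var_mpoly i)"
  by (simp add: homogeneous_altdef var_mpoly_def)

lemma homogeneous_1 [simp]: "homogeneous 0 (1 :: ('n::finite, 'a::comm_ring_1) mpoly)"
  by (simp add: homogeneous_altdef)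

lemma homogeneous_power: 
  fixes p :: "('n::finite, 'a::comm_ring_1) mpoly"
  shows "homogeneous d p \<Longrightarrow> homogeneous (d * k) (p ^ k)"
  by (induction k) (auto dest: homogeneous_mult)

lemma homogeneous_prod:
  fixes f :: "'i \<Rightarrow> ('n::finite, 'a::comm_ring_1) mpoly"
  assumes "finite A" "\<And>a. a \<in> A \<Longrightarrow> homogeneous (d a) (f a)"
  shows "homogeneous (sum d A) (prod f A)"
  using assms by (induction A rule: finite_induct) (auto intro: homogeneous_mult)

lemma homogeneous_comp:
  fixes F :: "'n::finite \<Rightarrow> ('n, 'a::comm_ring_1) mpoly"
  assumes F: "homogeneous d (F i)" and G: "\<And>j. homogeneous e (G j)"
  shows "homogeneous (d * e) (mor_comp F G i)"
  unfolding mor_comp_def eval_mpoly_def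
proof (intro homogeneous_sum homogeneous_const_mult)
  fix m assume m: "m \<in> Poly_Mapping.keys (F i)"
  have "homogeneous (\<Sum>i\<in>UNIV. e * Poly_Mapping.lookup m i) (\<Prod>i\<in>UNIV. G i ^ Poly_Mapping.lookup m i)"
    by (intro homogeneous_prod homogeneous_power G) auto
  moreover have "(\<Sum>i\<in>UNIV. e * Poly_Mapping.lookup m i) = d * e"
    using F m by (simp add: homogeneous_def sum_distrib_left[symmetric])
  ultimately show "homogeneous (d * e) (\<Prod>i\<in>UNIV. G i ^ Poly_Mapping.lookup m i)" by simp
qed

lemma homogeneous_linear: "homogeneous 1 (linear_mor A i)"
  unfolding linear_mor_def by (intro homogeneous_sum homogeneous_const_mult homogeneous_var)

lemma homogeneous_iterate:
  fixes F :: "'n::finite \<Rightarrow> ('n, 'a::comm_ring_1) mpoly"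
  assumes "\<And>i. homogeneous d (F i)"
  shows "homogeneous (d ^ r) (mor_iterate F r i)"
proof (induction r arbitrary: i)
  case 0 show ?case using homogeneous_var by simp
next
  case (Suc r)
  thus ?case using homogeneous_comp[of d F i "d ^ r" "mor_iterate F r", OF assms Suc] by (simp add: mor_iterate_Suc)
qed

lemma homogeneous_mor_conj:
  assumes "\<And>i. homogeneous d (F i)"
  shows "homogeneous d (mor_conj A F i)"
proof -
  have "homogeneous (d * 1) (mor_comp F (linear_mor A) j)" for j
    by (intro homogeneous_comp assms homogeneous_linear)
  hence "homogeneous (1 * d) (mor_conj A F i)"
    unfolding mor_conj_def by (intro homogeneous_comp homogeneous_linear) simp
  thus ?thesis by simp
qed

section \<open>Rescaling of tuples of forms\<close>

text \<open>Another lift of the same morphism of projective space, when \<open>c\<close> is a unit.\<close>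

abbreviation scale_mor :: "'a::comm_ring_1 \<Rightarrow> ('n \<Rightarrow> ('n, 'a) mpoly) \<Rightarrow> 'n \<Rightarrow> ('n, 'a) mpoly" where
  "scale_mor c F \<equiv> \<lambda>i. const_mpoly c * F i"

lemma mor_comp_scale_left: "mor_comp (scale_mor c F) G = scale_mor c (mor_comp F G)"
  by (auto simp: mor_comp_def eval_mpoly_mult)

lemma mor_comp_scale_right:
  assumes "\<And>i. homogeneous d (F i)"
  shows "mor_comp F (scale_mor c G) = scale_mor (c ^ d) (mor_comp F G)"
proof
  fix i
  have "(\<Prod>j\<in>UNIV. (const_mpoly c * G j) ^ Poly_Mapping.lookup m j)
      = const_mpoly (c ^ d) * (\<Prod>j\<in>UNIV. G j ^ Poly_Mapping.lookup m j)"
    if "m \<in> Poly_Mapping.keys (F i)" for m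
    using assms[of i] that
    by (auto simp: homogeneous_def power_mult_distrib prod.distrib power_sum[symmetric]
        coeff_hom_power[OF coeff_hom_const])
  thus "mor_comp F (scale_mor c G) i = const_mpoly (c ^ d) * mor_comp F G i"
    by (simp add: mor_comp_def eval_mpoly_def sum_distrib_left mult_ac)
qed

text \<open>Each iteration raises the factors accumulated so far to the \<open>d\<close>-th power, hence the geometric sum
  in the exponent.\<close>

lemma mor_iterate_scale:
  assumes "\<And>i. homogeneous d (F i)"
  shows "mor_iterate (scale_mor c F) r = scale_mor (c ^ (\<Sum>i<r. d ^ i)) (mor_iterate F r)"
proof (induction r)
  case 0 show ?case by simp
next
  case (Suc r)
  have "(\<Sum>i<Suc r. d ^ i) = 1 + (\<Sum>i<r. d ^ i) * d"
    by (simp only: sum.lessThan_Suc_shift power_Suc sum_distrib_right mult.commute[of d]) simp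
  hence "c ^ (\<Sum>i<Suc r. d ^ i) = c * (c ^ (\<Sum>i<r. d ^ i)) ^ d"
    by (simp only: power_add power_mult power_one_right)
  moreover have "mor_iterate (scale_mor c F) (Suc r)
      = scale_mor c (scale_mor ((c ^ (\<Sum>i<r. d ^ i)) ^ d) (mor_comp F (mor_iterate F r)))"
    by (simp only: mor_iterate_Suc Suc mor_comp_scale_left mor_comp_scale_right[OF assms])
  ultimately show ?case
    by (simp only: mor_iterate_Suc const_mpoly_mult mult.assoc)
qed

section \<open>Tuples without common zeros\<close>

text \<open>No common zero except possibly the origin, among the points with coordinates in the coefficient
  ring itself.\<close>

definition nonvanishing :: "('n::finite \<Rightarrow> ('n, 'b::comm_ring_1) mpoly) \<Rightarrow> bool" where
  "nonvanishing F \<longleftrightarrow> (\<forall>x. (\<forall>i. eval_mpoly id x (F i) = 0) \<longrightarrow> (\<forall>i. x i = 0))"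

lemma nonvanishing_comp: "nonvanishing F \<Longrightarrow> nonvanishing G \<Longrightarrow> nonvanishing (mor_comp F G)"
  by (auto simp: nonvanishing_def eval_mor_comp)

lemma nonvanishing_var: "nonvanishing var_mpoly"
  by (simp add: nonvanishing_def)

lemma nonvanishing_iterate: "nonvanishing F \<Longrightarrow> nonvanishing (mor_iterate F r)"
  by (induction r) (auto simp: mor_iterate_Suc nonvanishing_var intro: nonvanishing_comp)

lemma nonvanishing_left_inverse:
  assumes "mor_comp (linear_mor B) (linear_mor A) = var_mpoly"
  shows "nonvanishing (linear_mor A)"
  unfolding nonvanishing_def
proof (intro allI impI)
  fix x i assume *: "\<forall>i. eval_mpoly id x (linear_mor A i) = 0"
  have "x i = eval_mpoly id x (mor_comp (linear_mor B) (linear_mor A) i)"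
    by (simp add: assms)
  also have "\<dots> = eval_mpoly id (\<lambda>_. 0) (linear_mor B i)"
    using * by (simp add: eval_mor_comp)
  also have "\<dots> = 0" by (simp add: linear_mor_def eval_mpoly_sum eval_mpoly_mult)
  finally show "x i = 0" .
qed

lemma nonvanishing_mor_conj:
  assumes "invertible A" "nonvanishing F"
  shows "nonvanishing (mor_conj A F)"
  unfolding mor_conj_def
  using linear_matrix_inv[OF assms(1)] assms(2) nonvanishing_left_inverse
  by (intro nonvanishing_comp) blast+

lemma nonvanishing_scale:
  fixes c :: "'b::field"
  assumes "c \<noteq> 0" "nonvanishing F"
  shows "nonvanishing (scale_mor c F)"
  using assms by (auto simp: nonvanishing_def eval_mpoly_mult)

lemma proj_morphism_altdef:
  "proj_morphism L d F \<longleftrightarrow> (\<forall>i. homogeneous d (F i)) \<and> (\<forall>i m. Poly_Mapping.lookup (F i) m \<in> L) \<and> nonvanishing F"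
  by (auto simp: proj_morphism_def nonvanishing_def)

section \<open>Polynomials in a subset of the indeterminates\<close>

lemma lookup_const_mult: "Poly_Mapping.lookup (const_mpoly c * p) m = (c::'a::comm_ring_1) * Poly_Mapping.lookup p m"
  by (simp add: const_mpoly_def mult_map_scale_conv_mult[symmetric] map.rep_eq when_def)

text \<open>Polynomials that involve only the indeterminates in \<open>V\<close>. Rings in fewer indeterminates are
  represented as subrings of one polynomial type, so that one can induct on \<open>V\<close>.\<close>

definition polys_in :: "'n::finite set \<Rightarrow> ('n, 'a::comm_ring_1) mpoly set" where
  "polys_in V = {p. \<forall>m\<in>Poly_Mapping.keys p. Poly_Mapping.keys m \<subseteq> V}"

lemma polys_in_0 [simp]: "0 \<in> polys_in V"
  and polys_in_1 [simp]: "1 \<in> polys_in V"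
  and polys_in_const [simp]: "const_mpoly c \<in> polys_in V"
  and polys_in_UNIV [simp]: "p \<in> polys_in UNIV"
  by (auto simp: polys_in_def const_mpoly_def)

lemma polys_in_var [simp]: "i \<in> V \<Longrightarrow> var_mpoly i \<in> polys_in V"
  by (auto simp: polys_in_def var_mpoly_def)

lemma polys_in_add: "p \<in> polys_in V \<Longrightarrow> q \<in> polys_in V \<Longrightarrow> p + q \<in> polys_in V"
  using keys_add[of p q] unfolding polys_in_def by blast

lemma polys_in_mult: "p \<in> polys_in V \<Longrightarrow> q \<in> polys_in V \<Longrightarrow> p * q \<in> polys_in V"
proof -
  assume pq: "p \<in> polys_in V" "q \<in> polys_in V"
  have "Poly_Mapping.keys m \<subseteq> V" if "m \<in> Poly_Mapping.keys (p * q)" for m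
  proof -
    obtain a b where "a \<in> Poly_Mapping.keys p" "b \<in> Poly_Mapping.keys q" "m = a + b"
      using keys_mult[of p q] \<open>m \<in> _\<close> by blast
    thus ?thesis using pq keys_add[of a b] unfolding polys_in_def by blast
  qed
  thus ?thesis by (simp add: polys_in_def)
qed

lemma polys_in_uminus: "p \<in> polys_in V \<Longrightarrow> - p \<in> polys_in V"
  by (auto simp: polys_in_def in_keys_iff)

lemma polys_in_diff: "p \<in> polys_in V \<Longrightarrow> q \<in> polys_in V \<Longrightarrow> p - q \<in> polys_in V"
  using polys_in_add[of p V "- q"] polys_in_uminus by auto

lemma polys_in_prod: "(\<And>a. a \<in> A \<Longrightarrow> f a \<in> polys_in V) \<Longrightarrow> prod f A \<in> polys_in V"
  by (induction A rule: infinite_finite_induct) (auto intro: polys_in_mult)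

lemma polys_in_power: "p \<in> polys_in V \<Longrightarrow> p ^ k \<in> polys_in V"
  by (induction k) (auto intro: polys_in_mult)

lemma eval_mpoly_cong:
  assumes "p \<in> polys_in V" "\<And>i. i \<in> V \<Longrightarrow> x i = y i"
  shows "eval_mpoly h x p = eval_mpoly h y p"
  unfolding eval_mpoly_def
proof (intro sum.cong refl arg_cong2[of _ _ _ _ "(*)"] prod.cong)
  fix m i assume "m \<in> Poly_Mapping.keys p"
  hence "i \<in> V \<or> i \<notin> Poly_Mapping.keys m"
    using assms(1) by (auto simp: polys_in_def)
  hence "i \<in> V \<or> Poly_Mapping.lookup m i = 0"
    by (simp add: in_keys_iff)
  thus "x i ^ Poly_Mapping.lookup m i = y i ^ Poly_Mapping.lookup m i"
    using assms(2) by auto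
qed

lemma single_polys_in_insert:
  assumes "Poly_Mapping.keys m \<subseteq> insert n V" "n \<notin> V"
  obtains b :: "('n::finite, 'a::comm_ring_1) mpoly" where "b \<in> polys_in V"
    "Poly_Mapping.single m c = b * var_mpoly n ^ Poly_Mapping.lookup m n"
proof
  let ?f = "\<lambda>i. var_mpoly i ^ Poly_Mapping.lookup m i :: ('n, 'a) mpoly"
  show "const_mpoly c * prod ?f V \<in> polys_in V"
    by (intro polys_in_mult polys_in_prod polys_in_power) auto
  have "Poly_Mapping.lookup m i = 0" if "i \<notin> insert n V" for i
    using assms(1) that by (meson in_keys_iff subsetD)
  hence "prod ?f UNIV = prod ?f (insert n V)"
    by (intro prod.mono_neutral_right) auto
  thus "Poly_Mapping.single m c = const_mpoly c * prod ?f V * ?f n"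
    using assms(2) by (simp add: single_eq_prod_var mult_ac)
qed

section \<open>Homogeneous components\<close>

text \<open>The homogeneous component of degree \<open>d\<close>.\<close>

definition hcomp :: "nat \<Rightarrow> ('n::finite, 'a::comm_ring_1) mpoly \<Rightarrow> ('n, 'a) mpoly" where
  "hcomp d p = (\<Sum>m\<in>Poly_Mapping.keys p. if mdeg m = d then Poly_Mapping.single m (Poly_Mapping.lookup p m) else 0)"

lemma lookup_hcomp: "Poly_Mapping.lookup (hcomp d p) m = (if mdeg m = d then Poly_Mapping.lookup p m else 0)"
proof -
  have "Poly_Mapping.lookup (hcomp d p) m = (\<Sum>k\<in>Poly_Mapping.keys p. if k = m then
      (if mdeg m = d then Poly_Mapping.lookup p m else 0) else 0)"
    unfolding hcomp_def lookup_sum by (intro sum.cong) (auto simp: lookup_single when_def)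
  thus ?thesis by (auto simp: in_keys_iff)
qed

lemma homogeneous_hcomp: "homogeneous d (hcomp d p)"
  by (auto simp: homogeneous_altdef in_keys_iff lookup_hcomp split: if_splits)

lemma hcomp_polys_in: "p \<in> polys_in V \<Longrightarrow> hcomp d p \<in> polys_in V"
  by (auto simp: polys_in_def in_keys_iff lookup_hcomp split: if_splits)

lemma hcomp_sum: "hcomp d (sum f A) = (\<Sum>a\<in>A. hcomp d (f a))"
  by (rule poly_mapping_eqI) (auto simp: lookup_hcomp lookup_sum)

lemma sum_hcomp: "(\<Sum>d\<in>mdeg ` Poly_Mapping.keys p. hcomp d p) = p"
  by (rule poly_mapping_eqI) (auto simp: lookup_hcomp lookup_sum in_keys_iff sum.delta image_iff)

lemma hcomp_homogeneous: "homogeneous d p \<Longrightarrow> hcomp k p = (if k = d then p else 0)"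
  by (rule poly_mapping_eqI) (auto simp: lookup_hcomp homogeneous_altdef in_keys_iff)

lemma hcomp_mult_homogeneous:
  assumes "homogeneous e q"
  shows "hcomp k (p * q) = (if e \<le> k then hcomp (k - e) p else 0) * q"
proof -
  have "hcomp k (p * q) = hcomp k (\<Sum>d\<in>mdeg ` Poly_Mapping.keys p. hcomp d p * q)"
    by (simp only: sum_distrib_right[symmetric] sum_hcomp)
  also have "\<dots> = (\<Sum>d\<in>mdeg ` Poly_Mapping.keys p. if k = d + e then hcomp d p * q else 0)"
    by (simp add: hcomp_sum hcomp_homogeneous[OF homogeneous_mult[OF homogeneous_hcomp assms]])
  also have "\<dots> = (if e \<le> k then (\<Sum>d\<in>mdeg ` Poly_Mapping.keys p. hcomp (k - e) (hcomp d p)) else 0) * q"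
  proof (cases "e \<le> k")
    case True
    hence "(k = d + e) = (k - e = d)" for d by auto
    thus ?thesis using True
      by (auto simp: sum_distrib_right hcomp_homogeneous[OF homogeneous_hcomp] intro!: sum.cong)
  qed (auto intro!: sum.neutral)
  also have "\<dots> = (if e \<le> k then hcomp (k - e) p else 0) * q"
    by (simp only: hcomp_sum[symmetric] sum_hcomp)
  finally show ?thesis .
qed

section \<open>Homogeneous ideals\<close>

text \<open>Ideals of the polynomial ring that contain the homogeneous components of their elements.\<close>

locale homogeneous_ideal =
  fixes I :: "('n::finite, 'b::alg_closed_field) mpoly set"
  assumes zero: "0 \<in> I"
    and add: "p \<in> I \<Longrightarrow> q \<in> I \<Longrightarrow> p + q \<in> I"
    and mult: "p \<in> I \<Longrightarrow> q * p \<in> I"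
    and hcomp: "p \<in> I \<Longrightarrow> hcomp d p \<in> I"
begin

lemma diff: "p \<in> I \<Longrightarrow> q \<in> I \<Longrightarrow> p - q \<in> I"
  using add[of p "- q"] mult[of q "- 1"] by simp

lemma sum: "(\<And>a. a \<in> A \<Longrightarrow> f a \<in> I) \<Longrightarrow> sum f A \<in> I"
  by (induction A rule: infinite_finite_induct) (auto intro: add zero)

text \<open>The elimination ideal \<open>I \<inter> polys_in V\<close> has no zero except the origin in the coordinate subspace
  belonging to \<open>V\<close>.\<close>

definition no_zero :: "'n set \<Rightarrow> bool" where
  "no_zero V \<longleftrightarrow> (\<forall>a. (\<forall>i. i \<notin> V \<longrightarrow> a i = 0) \<and> (\<forall>p\<in>I \<inter> polys_in V. eval_mpoly id a p = 0) \<longrightarrow> (\<forall>i. a i = 0))"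

text \<open>The \<open>n\<close>-th coordinate point is not a zero, so some component of an element of the ideal contains a
  pure power of the \<open>n\<close>-th indeterminate.\<close>

lemma exists_monic:
  assumes "no_zero V" "n \<in> V"
  obtains f d where "f \<in> I" "f \<in> polys_in V" "homogeneous d f"
    "Poly_Mapping.lookup f (Poly_Mapping.single n d) = 1"
proof -
  define a :: "'n \<Rightarrow> 'b" where "a = (\<lambda>i. if i = n then 1 else 0)"
  obtain p where p: "p \<in> I" "p \<in> polys_in V" "eval_mpoly id a p \<noteq> 0"
  proof -
    have "\<forall>i. i \<notin> V \<longrightarrow> a i = 0" "a n \<noteq> 0" using assms(2) by (auto simp: a_def)
    thus thesis using that spec[OF assms(1)[unfolded no_zero_def], of a] by blast
  qed
  have "eval_mpoly id a p = (\<Sum>d\<in>mdeg ` Poly_Mapping.keys p. eval_mpoly id a (hcomp d p))"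
    by (simp only: eval_mpoly_sum[OF coeff_hom_id, symmetric] sum_hcomp)
  then obtain d where d: "eval_mpoly id a (hcomp d p) \<noteq> 0"
    using p(3) by (metis (mono_tags, lifting) sum.neutral)
  then obtain m where m: "m \<in> Poly_Mapping.keys (hcomp d p)"
    and nz: "(\<Prod>i\<in>UNIV. a i ^ Poly_Mapping.lookup m i) \<noteq> 0"
  proof -
    have "\<exists>m\<in>Poly_Mapping.keys (hcomp d p). id (Poly_Mapping.lookup (hcomp d p) m) *
        (\<Prod>i\<in>UNIV. a i ^ Poly_Mapping.lookup m i) \<noteq> 0"
      using d unfolding eval_mpoly_def by (meson sum.neutral)
    thus thesis using that by auto
  qed
  have "Poly_Mapping.lookup m i = 0" if "i \<noteq> n" for i
    using nz that by (auto simp: a_def zero_power)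
  hence "m = Poly_Mapping.single n (Poly_Mapping.lookup m n)"
    by (intro poly_mapping_eqI) (auto simp: lookup_single when_def)
  moreover have "mdeg m = d"
    using homogeneous_hcomp m unfolding homogeneous_altdef by blast
  ultimately have md: "m = Poly_Mapping.single n d" by (metis mdeg_single)
  define c where "c = Poly_Mapping.lookup (hcomp d p) m"
  have c: "c \<noteq> 0" using m by (simp add: c_def in_keys_iff)
  show thesis
  proof
    show "const_mpoly (inverse c) * hcomp d p \<in> I" by (intro mult hcomp p)
    show "const_mpoly (inverse c) * hcomp d p \<in> polys_in V" 
      by (intro polys_in_mult hcomp_polys_in p) simp
    show "homogeneous d (const_mpoly (inverse c) * hcomp d p)"
      by (intro homogeneous_const_mult homogeneous_hcomp)
    show "Poly_Mapping.lookup (const_mpoly (inverse c) * hcomp d p) (Poly_Mapping.single n d) = 1"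
      using c by (simp add: lookup_const_mult md[symmetric] c_def)
  qed
qed

text \<open>
  A substitute for Cramer's rule. If \<open>M\<close> specialises to the identity matrix under \<open>e\<close> and maps the
  vector \<open>y\<close> into \<open>I\<close>, then some \<open>u\<close> that specialises to \<open>1\<close> multiplies every entry of \<open>y\<close> into \<open>I\<close>.
  The last unknown is eliminated without division, which keeps the entries in \<open>polys_in V\<close> and the
  specialisation equal to the identity.
\<close>

lemma eliminate_unknowns:
  fixes d :: nat
  assumes e: "coeff_hom e"
  shows "(\<forall>i<d. \<forall>j<d. M i j \<in> polys_in V \<and> e (M i j) = (if i = j then 1 else (0::'b))) \<Longrightarrow>
     (\<forall>i<d. (\<Sum>j<d. M i j * y j) \<in> I) \<Longrightarrow>
     \<exists>u\<in>polys_in V. e u = 1 \<and> (\<forall>j<d. u * y j \<in> I)"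
proof (induction d arbitrary: M)
  case 0
  show ?case using coeff_homD(2)[OF e] by (intro bexI[of _ 1]) auto
next
  case (Suc d)
  define M' where "M' i j = M d d * M i j - M i d * M d j" for i j
  have e_diff: "e (p - q) = e p - e q" for p q
    using coeff_homD(3)[OF e, of p "- q"] coeff_hom_uminus[OF e] by simp
  have "\<forall>i<d. \<forall>j<d. M' i j \<in> polys_in V \<and> e (M' i j) = (if i = j then 1 else 0)"
    using Suc.prems(1) unfolding M'_def
    by (auto intro!: polys_in_diff polys_in_mult simp: e_diff coeff_homD[OF e])
  moreover have "\<forall>i<d. (\<Sum>j<d. M' i j * y j) \<in> I"
  proof safe
    fix i assume i: "i < d"
    have "(\<Sum>j<d. M' i j * y j) = M d d * (\<Sum>j<d. M i j * y j) - M i d * (\<Sum>j<d. M d j * y j)"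
      by (simp add: M'_def sum_distrib_left sum_subtractf[symmetric] algebra_simps)
    also have "\<dots> = M d d * (\<Sum>j<Suc d. M i j * y j) - M i d * (\<Sum>j<Suc d. M d j * y j)"
      by (simp add: algebra_simps)
    also have "\<dots> \<in> I" using Suc.prems(2) i by (intro diff mult) auto
    finally show "(\<Sum>j<d. M' i j * y j) \<in> I" .
  qed
  ultimately obtain u where u: "u \<in> polys_in V" "e u = 1" "\<And>j. j < d \<Longrightarrow> u * y j \<in> I"
    using Suc.IH[of M'] by auto
  show ?case
  proof (intro bexI conjI allI impI)
    show "M d d * u \<in> polys_in V" using Suc.prems(1) u by (intro polys_in_mult) auto
    show "e (M d d * u) = 1" using Suc.prems(1) u by (simp add: coeff_homD[OF e])
    fix j assume "j < Suc d"
    then consider "j < d" | "j = d" by linarith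
    thus "M d d * u * y j \<in> I"
    proof cases
      case 1
      thus ?thesis using mult[OF u(3)[OF 1], of "M d d"] by (simp add: mult_ac)
    next
      case 2
      have "M d d * u * y d = u * (\<Sum>j<Suc d. M d j * y j) - (\<Sum>j<d. M d j * (u * y j))"
        by (simp add: algebra_simps sum_distrib_left)
      also have "\<dots> \<in> I"
      proof (rule diff)
        show "u * (\<Sum>j<Suc d. M d j * y j) \<in> I" using Suc.prems(2) by (intro mult) auto
        show "(\<Sum>j<d. M d j * (u * y j)) \<in> I" by (rule sum, rule mult) (auto intro: u(3))
      qed
      finally show ?thesis using 2 by simp
    qed
  qed
qed

end

section \<open>Division by a monic polynomial\<close>

text \<open>Polynomials of degree less than \<open>d\<close> in the \<open>n\<close>-th indeterminate, with coefficients involving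
  only the indeterminates in \<open>V\<close>.\<close>

definition low_degree :: "'n::finite \<Rightarrow> 'n set \<Rightarrow> nat \<Rightarrow> ('n, 'a::comm_ring_1) mpoly set" where
  "low_degree n V d = {p. \<exists>a. (\<forall>i<d. a i \<in> polys_in V) \<and> p = (\<Sum>i<d. a i * var_mpoly n ^ i)}"

lemma low_degree_0: "0 \<in> low_degree n V d"
  unfolding low_degree_def by (intro CollectI exI[of _ "\<lambda>_. 0"]) auto

lemma low_degree_add: assumes "p \<in> low_degree n V d" "q \<in> low_degree n V d" shows "p + q \<in> low_degree n V d"
proof -
  obtain a b where "\<forall>i<d. a i \<in> polys_in V" "p = (\<Sum>i<d. a i * var_mpoly n ^ i)"
    "\<forall>i<d. b i \<in> polys_in V" "q = (\<Sum>i<d. b i * var_mpoly n ^ i)"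
    using assms unfolding low_degree_def by blast
  thus ?thesis unfolding low_degree_def
    by (intro CollectI exI[of _ "\<lambda>i. a i + b i"]) (auto simp: polys_in_add sum.distrib distrib_right)
qed

lemma low_degree_mult: assumes "p \<in> low_degree n V d" "q \<in> polys_in V" shows "q * p \<in> low_degree n V d"
proof -
  obtain a where "\<forall>i<d. a i \<in> polys_in V" "p = (\<Sum>i<d. a i * var_mpoly n ^ i)"
    using assms unfolding low_degree_def by blast
  thus ?thesis unfolding low_degree_def using assms(2)
    by (intro CollectI exI[of _ "\<lambda>i. q * a i"]) (auto simp: polys_in_mult sum_distrib_left mult_ac)
qed

lemma low_degree_sum: "(\<And>a. a \<in> A \<Longrightarrow> f a \<in> low_degree n V d) \<Longrightarrow> sum f A \<in> low_degree n V d"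
  by (induction A rule: infinite_finite_induct) (auto intro: low_degree_add low_degree_0)

lemma low_degree_monomial:
  assumes "b \<in> polys_in V" "k < d" shows "b * var_mpoly n ^ k \<in> low_degree n V d"
  unfolding low_degree_def
proof (intro CollectI exI[of _ "\<lambda>i. if i = k then b else 0"] conjI)
  have "(\<Sum>i<d. (if i = k then b else 0) * var_mpoly n ^ i) = (\<Sum>i<d. if i = k then b * var_mpoly n ^ k else 0)"
    by (intro sum.cong) auto
  thus "b * var_mpoly n ^ k = (\<Sum>i<d. (if i = k then b else 0) * var_mpoly n ^ i)"
    using assms by simp
qed (use assms in auto)

lemma low_degreeI:
  fixes r :: "('n::finite, 'a::comm_ring_1) mpoly"
  assumes "r \<in> polys_in (insert n V)" "n \<notin> V" "\<And>m. m \<in> Poly_Mapping.keys r \<Longrightarrow> Poly_Mapping.lookup m n < d"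
  shows "r \<in> low_degree n V d"
proof -
  have "(\<Sum>m\<in>Poly_Mapping.keys r. Poly_Mapping.single m (Poly_Mapping.lookup r m)) \<in> low_degree n V d"
  proof (intro low_degree_sum)
    fix m assume m: "m \<in> Poly_Mapping.keys r"
    hence "Poly_Mapping.keys m \<subseteq> insert n V" using assms(1) by (auto simp: polys_in_def)
    then obtain b :: "('n, 'a) mpoly" where "b \<in> polys_in V"
      "Poly_Mapping.single m (Poly_Mapping.lookup r m) = b * var_mpoly n ^ Poly_Mapping.lookup m n"
      using assms(2) single_polys_in_insert by metis
    thus "Poly_Mapping.single m (Poly_Mapping.lookup r m) \<in> low_degree n V d"
      using low_degree_monomial assms(3)[OF m] by metis
  qed
  thus ?thesis by (simp add: sum_single_lookup)
qed

text \<open>The premise on \<open>f\<close> says that it is monic of degree \<open>d\<close> in the \<open>n\<close>-th indeterminate.\<close>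

lemma division_with_remainder:
  fixes f :: "('n::finite, 'a::comm_ring_1) mpoly"
  assumes n: "n \<notin> V" and d: "d > 0" and r: "var_mpoly n ^ d - f \<in> low_degree n V d"
    and p: "p \<in> polys_in (insert n V)"
  obtains q s where "s \<in> low_degree n V d" "p = f * q + s"
proof -
  define Q where "Q = {p. \<exists>q s. s \<in> low_degree n V d \<and> p = f * q + s}"
  have Q_add: "p + p' \<in> Q" if pp: "p \<in> Q" "p' \<in> Q" for p p'
  proof -
    obtain q s q' s' where "s \<in> low_degree n V d" "p = f * q + s" "s' \<in> low_degree n V d" "p' = f * q' + s'"
      using pp unfolding Q_def by blast
    thus ?thesis unfolding Q_def
      by (intro CollectI exI[of _ "q + q'"] exI[of _ "s + s'"]) (auto simp: low_degree_add algebra_simps)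
  qed
  have Q_mult: "b * p \<in> Q" if pb: "p \<in> Q" "b \<in> polys_in V" for p b
  proof -
    obtain q s where "s \<in> low_degree n V d" "p = f * q + s" using pb unfolding Q_def by blast
    thus ?thesis unfolding Q_def using pb(2)
      by (intro CollectI exI[of _ "b * q"] exI[of _ "b * s"]) (auto simp: low_degree_mult algebra_simps)
  qed
  have Q_sum: "sum g A \<in> Q" if "\<And>a. a \<in> A \<Longrightarrow> g a \<in> Q" for g and A :: "'z set"
  proof -
    have "0 \<in> Q" unfolding Q_def using low_degree_0 by (intro CollectI exI[of _ 0]) auto
    thus ?thesis using that by (induction A rule: infinite_finite_induct) (auto intro: Q_add)
  qed
  have var_Q: "var_mpoly n ^ k \<in> Q" for k
  proof (induction k rule: less_induct)
    case (less k)
    show ?case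
    proof (cases "k < d")
      case True
      hence "1 * var_mpoly n ^ k \<in> low_degree n V d" by (intro low_degree_monomial) auto
      thus ?thesis unfolding Q_def by (intro CollectI exI[of _ 0] exI[of _ "var_mpoly n ^ k"]) auto
    next
      case False
      obtain a where a: "\<forall>i<d. a i \<in> polys_in V" "var_mpoly n ^ d - f = (\<Sum>i<d. a i * var_mpoly n ^ i)"
        using r unfolding low_degree_def by blast
      have "(\<Sum>i<d. a i * var_mpoly n ^ (i + (k - d))) \<in> Q"
        using False a(1) by (intro Q_sum Q_mult less.IH) auto
      moreover have "f * var_mpoly n ^ (k - d) \<in> Q"
        unfolding Q_def using low_degree_0 by (intro CollectI exI[of _ "var_mpoly n ^ (k - d)"] exI[of _ 0]) auto
      moreover have "var_mpoly n ^ k = var_mpoly n ^ (k - d) * (f + (\<Sum>i<d. a i * var_mpoly n ^ i))"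
        using False a(2)[symmetric] by (simp add: power_add[symmetric])
      hence "var_mpoly n ^ k = f * var_mpoly n ^ (k - d) + (\<Sum>i<d. a i * var_mpoly n ^ (i + (k - d)))"
        by (simp add: algebra_simps sum_distrib_left power_add)
      ultimately show ?thesis by (simp add: Q_add)
    qed
  qed
  have "(\<Sum>m\<in>Poly_Mapping.keys p. Poly_Mapping.single m (Poly_Mapping.lookup p m)) \<in> Q"
  proof (intro Q_sum)
    fix m assume m: "m \<in> Poly_Mapping.keys p"
    hence "Poly_Mapping.keys m \<subseteq> insert n V" using p by (auto simp: polys_in_def)
    then obtain b :: "('n, 'a) mpoly" where "b \<in> polys_in V"
      "Poly_Mapping.single m (Poly_Mapping.lookup p m) = b * var_mpoly n ^ Poly_Mapping.lookup m n"
      using n single_polys_in_insert by metis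
    thus "Poly_Mapping.single m (Poly_Mapping.lookup p m) \<in> Q"
      using Q_mult var_Q by metis
  qed
  hence "p \<in> Q" by (simp add: sum_single_lookup)
  thus thesis using that unfolding Q_def by blast
qed

lemma coeff_sum_low_degree: "Polynomial.coeff (\<Sum>j<d. [:c j:] * [:0, 1:] ^ j) k = (if k < d then c k else (0::'a::comm_ring_1))"
proof -
  have "(\<Sum>j<d. [:c j:] * [:0, 1:] ^ j) = (\<Sum>j<d. Polynomial.monom (c j) j)"
    by (simp add: monom_altdef)
  thus ?thesis by (simp add: coeff_sum)
qed

section \<open>The homogeneous Nullstellensatz\<close>

context homogeneous_ideal
begin

text \<open>
  The main theorem of elimination theory, in the form needed here: a nontrivial zero \<open>a\<close> of the
  elimination ideal for \<open>V\<close> extends to a zero of the elimination ideal \<open>J\<close> for \<open>insert n V\<close>. If it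
  does not, the polynomials \<open>g(a, t)\<close> with \<open>g \<in> J\<close> have no common root, and they form an ideal of the
  principal ideal ring of polynomials in \<open>t\<close>; hence \<open>g(a, t) = 1\<close> for some \<open>g\<close>. Take a monic \<open>f \<in> J\<close>. The
  matrix of multiplication by \<open>g\<close> modulo \<open>f\<close> specialises to the identity matrix at \<open>a\<close>, and
  elimination yields an element of \<open>I \<inter> polys_in V\<close> with value \<open>1\<close> at \<open>a\<close>.
\<close>

lemma no_zero_remove:
  assumes n: "n \<notin> V" and nz: "no_zero (insert n V)"
  shows "no_zero V"
  unfolding no_zero_def
proof (intro allI impI, rule ccontr)
  fix a i
  assume "(\<forall>i. i \<notin> V \<longrightarrow> a i = 0) \<and> (\<forall>p\<in>I \<inter> polys_in V. eval_mpoly id a p = 0)"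
  hence supp: "\<And>i. i \<notin> V \<Longrightarrow> a i = 0" and van: "\<And>p. p \<in> I \<Longrightarrow> p \<in> polys_in V \<Longrightarrow> eval_mpoly id a p = 0"
    by auto
  assume ai: "a i \<noteq> 0"
  let ?V = "insert n V" and ?x = "var_mpoly n :: ('n, 'b) mpoly"
  obtain f d where f: "f \<in> I" "f \<in> polys_in ?V" "homogeneous d f"
    and lf: "Poly_Mapping.lookup f (Poly_Mapping.single n d) = 1"
    using exists_monic[OF nz] by blast
  have d: "d > 0"
  proof (rule ccontr)
    assume "\<not> d > 0"
    hence d0: "d = 0" by simp
    have "m = 0" if "m \<in> Poly_Mapping.keys f" for m
      using f(3) that d0 by (intro poly_mapping_eqI) (auto simp: homogeneous_def)
    hence "f = 1"
      using lf d0 by (intro poly_mapping_eqI) (auto simp: lookup_one when_def in_keys_iff)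
    thus False using van[OF f(1)] by (simp add: coeff_homD(2)[OF coeff_hom_eval])
  qed
  have r: "?x ^ d - f \<in> low_degree n V d"
  proof (rule low_degreeI[OF _ n])
    show "?x ^ d - f \<in> polys_in ?V" by (intro polys_in_diff polys_in_power f) simp
    fix m assume m: "m \<in> Poly_Mapping.keys (?x ^ d - f)"
    have xd: "?x ^ d = Poly_Mapping.single (Poly_Mapping.single n d) 1"
      by (rule var_mpoly_power)
    have "m \<noteq> Poly_Mapping.single n d" using m lf by (auto simp: in_keys_iff lookup_minus xd)
    moreover from this have "m \<in> Poly_Mapping.keys f"
      using m by (auto simp: in_keys_iff lookup_minus xd lookup_single when_def)
    hence md: "mdeg m = d" using f(3) by (auto simp: homogeneous_altdef)
    have "Poly_Mapping.lookup m n \<le> d" 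
      unfolding md[symmetric] mdeg_def by (rule member_le_sum) auto
    moreover have "m = Poly_Mapping.single n d" if mn: "Poly_Mapping.lookup m n = d"
    proof -
      have "mdeg m = Poly_Mapping.lookup m n + (\<Sum>i\<in>UNIV - {n}. Poly_Mapping.lookup m i)"
        unfolding mdeg_def by (rule sum.remove) auto
      hence "\<forall>i. i \<noteq> n \<longrightarrow> Poly_Mapping.lookup m i = 0" using md mn by auto
      thus ?thesis using mn by (intro poly_mapping_eqI) (auto simp: lookup_single when_def)
    qed
    ultimately show "Poly_Mapping.lookup m n < d" by fastforce
  qed
  \<comment> \<open>\<open>e p\<close> is \<open>p(a, t)\<close> as a polynomial in \<open>t\<close>.\<close>
  define e where "e = eval_mpoly (\<lambda>c::'b. [:c:]) (\<lambda>i. if i = n then [:0, 1:] else [:a i:])"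
  have hC: "coeff_hom (\<lambda>c::'b. [:c:])" by (simp add: coeff_hom_def one_pCons)
  have e: "coeff_hom e" unfolding e_def by (rule coeff_hom_eval[OF hC])
  note eD = coeff_homD[OF e]
  have e_diff: "e (p - q) = e p - e q" for p q
    using eD(3)[of p "- q"] coeff_hom_uminus[OF e] by simp
  have e_x: "e ?x = [:0, 1:]" by (simp add: e_def hC)
  have e_const: "e (const_mpoly c) = [:c:]" for c by (simp add: e_def hC)
  have e_in: "e p = [:eval_mpoly id a p:]" if "p \<in> polys_in V" for p
  proof -
    have "e p = eval_mpoly (\<lambda>c. [:c:]) (\<lambda>i. [:a i:]) p"
      unfolding e_def by (rule eval_mpoly_cong[OF that]) (use n in auto)
    thus ?thesis using hom_eval_mpoly[OF hC, of id a p] by (simp add: comp_def)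
  qed
  have e_poly: "poly (e p) t = eval_mpoly id (a(n := t)) p" for p t
  proof -
    have "coeff_hom (\<lambda>q. poly q t)" by (simp add: coeff_hom_def)
    from hom_eval_mpoly[OF this, of "\<lambda>c. [:c:]" "\<lambda>i. if i = n then [:0, 1:] else [:a i:]" p]
    have "poly (e p) t = eval_mpoly id (\<lambda>i. poly (if i = n then [:0, 1:] else [:a i:]) t) p"
      by (simp add: e_def comp_def id_def)
    also have "(\<lambda>i. poly (if i = n then [:0, 1:] else [:a i:]) t) = a(n := t)" by auto
    finally show ?thesis .
  qed
  have e_low: "\<exists>c. e s = (\<Sum>j<d. [:c j:] * [:0, 1:] ^ j)" if s: "s \<in> low_degree n V d" for s
  proof -
    obtain b where b: "\<forall>i<d. b i \<in> polys_in V" "s = (\<Sum>i<d. b i * ?x ^ i)"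
      using s unfolding low_degree_def by blast
    show ?thesis using b
      by (intro exI[of _ "\<lambda>j. eval_mpoly id a (b j)"])
        (auto simp: coeff_hom_sum[OF e] eD(4) coeff_hom_power[OF e] e_x e_in)
  qed
  have lift: "\<exists>Q\<in>polys_in ?V. e Q = q" for q :: "'b poly"
  proof (induction q)
    case 0 show ?case using eD(1) by (intro bexI[of _ 0]) auto
  next
    case (pCons c q)
    then obtain Q where "Q \<in> polys_in ?V" "e Q = q" by blast
    thus ?case by (intro bexI[of _ "const_mpoly c + ?x * Q"])
        (auto simp: eD e_const e_x intro!: polys_in_add polys_in_mult)
  qed
  have deg_f: "Polynomial.degree (e f) = d"
  proof -
    obtain c where c: "e (?x ^ d - f) = (\<Sum>j<d. [:c j:] * [:0, 1:] ^ j)" using e_low[OF r] by blast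
    have ef: "e f = [:0, 1:] ^ d - (\<Sum>j<d. [:c j:] * [:0, 1:] ^ j)"
      using c e_diff[of "?x ^ d" f] by (simp add: coeff_hom_power[OF e] e_x algebra_simps)
    have "Polynomial.coeff (e f) k = (if k = d then 1 else if k < d then - c k else 0)" for k
      unfolding ef coeff_diff coeff_sum_low_degree using monom_altdef[of "1::'b" d, symmetric] by simp
    thus ?thesis by (intro antisym degree_le le_degree) auto
  qed
  obtain g where g: "g \<in> I" "g \<in> polys_in ?V" "e g = 1"
  proof -
    \<comment> \<open>An element of least degree generates the ideal of all \<open>e p\<close>.\<close>
    let ?P = "\<lambda>p. p \<in> I \<and> p \<in> polys_in ?V \<and> e p \<noteq> 0"
    have "?P f" using f deg_f d by auto
    then obtain h where h: "?P h" and min: "\<And>p. ?P p \<Longrightarrow> Polynomial.degree (e h) \<le> Polynomial.degree (e p)"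
      using ex_has_least_nat[of ?P f "\<lambda>p. Polynomial.degree (e p)"] by blast
    have dvd: "e h dvd e p" if p: "p \<in> I" "p \<in> polys_in ?V" for p
    proof (rule ccontr)
      assume nd: "\<not> e h dvd e p"
      obtain Q where Q: "Q \<in> polys_in ?V" "e Q = e p div e h" using lift by blast
      have eq: "e (p - Q * h) = e p mod e h"
        by (simp add: e_diff eD(4) Q minus_div_mult_eq_mod)
      hence "?P (p - Q * h)"
        using p h Q nd by (auto intro!: diff mult polys_in_diff polys_in_mult simp: mod_eq_0_iff_dvd)
      from min[OF this] show False
        using degree_mod_less'[of "e h" "e p"] h nd by (simp add: eq mod_eq_0_iff_dvd)
    qed
    have "Polynomial.degree (e h) = 0"
    proof (rule ccontr)
      assume "Polynomial.degree (e h) \<noteq> 0"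
      then obtain t where t: "poly (e h) t = 0"
        using alg_closed_imp_poly_has_root by blast
      have "eval_mpoly id (a(n := t)) p = 0" if "p \<in> I \<inter> polys_in ?V" for p
        using dvd[of p] that t by (auto simp: e_poly[symmetric] elim!: dvdE)
      moreover have "\<forall>i. i \<notin> ?V \<longrightarrow> (a(n := t)) i = 0" using supp by simp
      ultimately have "\<forall>i. (a(n := t)) i = 0"
        using spec[OF nz[unfolded no_zero_def], of "a(n := t)"] by blast
      thus False using ai supp n by (metis fun_upd_other)
    qed
    then obtain c where c: "e h = [:c:]" by (metis degree_eq_zeroE)
    have "c \<noteq> 0" using h c by auto
    thus thesis using h c
      by (intro that[of "const_mpoly (inverse c) * h"])
        (auto intro!: mult polys_in_mult simp: eD(4) e_const one_pCons)
  qed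
  have "\<forall>i. \<exists>q s. s \<in> low_degree n V d \<and> g * ?x ^ i = f * q + s"
  proof
    fix i
    have "g * ?x ^ i \<in> polys_in ?V" by (intro polys_in_mult polys_in_power g) simp
    from division_with_remainder[OF n d r this]
    show "\<exists>q s. s \<in> low_degree n V d \<and> g * ?x ^ i = f * q + s" by blast
  qed
  then obtain q s where qs: "\<And>i. s i \<in> low_degree n V d" "\<And>i. g * ?x ^ i = f * q i + s i" by metis
  hence "\<forall>i. \<exists>b. (\<forall>j<d. b j \<in> polys_in V) \<and> s i = (\<Sum>j<d. b j * ?x ^ j)"
    unfolding low_degree_def by blast
  then obtain M where M: "\<And>i j. j < d \<Longrightarrow> M i j \<in> polys_in V" "\<And>i. s i = (\<Sum>j<d. M i j * ?x ^ j)"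
    by metis
  have MI: "eval_mpoly id a (M i j) = (if i = j then 1 else 0)" if ij: "i < d" "j < d" for i j
  proof -
    let ?m = "\<lambda>j. eval_mpoly id a (M i j)"
    have es: "e (s i) = (\<Sum>j<d. [:?m j:] * [:0, 1:] ^ j)"
      unfolding M(2) coeff_hom_sum[OF e]
      by (intro sum.cong) (auto simp: eD(4) coeff_hom_power[OF e] e_x e_in[OF M(1)])
    have "[:0, 1:] ^ i = e f * e (q i) + e (s i)"
      using arg_cong[OF qs(2)[of i], of e] by (simp add: eD coeff_hom_power[OF e] e_x g)
    hence eq: "e f * e (q i) = [:0, 1:] ^ i - e (s i)" by simp
    have co: "Polynomial.coeff ([:0, 1:] ^ i - e (s i)) k = (if k = i then 1 else 0) - (if k < d then ?m k else 0)" for k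
      unfolding es coeff_diff coeff_sum_low_degree using monom_altdef[of "1::'b" i, symmetric] by simp
    \<comment> \<open>A nonzero multiple of \<open>e f\<close> has degree at least \<open>d\<close>, but the right-hand side of \<open>eq\<close> has not.\<close>
    have "e (q i) = 0"
    proof (rule ccontr)
      assume "e (q i) \<noteq> 0"
      hence "Polynomial.degree (e f * e (q i)) \<ge> d"
        using deg_f d by (subst degree_mult_eq) auto
      moreover have "Polynomial.degree ([:0, 1:] ^ i - e (s i)) \<le> d - 1"
        by (rule degree_le) (use ij co in auto)
      ultimately show False using eq d by simp
    qed
    hence "Polynomial.coeff ([:0, 1:] ^ i - e (s i)) j = 0" using eq by simp
    thus ?thesis using co[of j] ij by (simp split: if_splits)
  qed
  have "(\<Sum>j<d. M i j * ?x ^ j) \<in> I" for i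
  proof -
    have "(\<Sum>j<d. M i j * ?x ^ j) = ?x ^ i * g - q i * f"
      using qs(2)[of i] M(2)[of i] by (simp add: algebra_simps)
    thus ?thesis using f g by (auto intro!: diff mult)
  qed
  hence "\<exists>u\<in>polys_in V. eval_mpoly id a u = 1 \<and> (\<forall>j<d. u * ?x ^ j \<in> I)"
    using M MI by (intro eliminate_unknowns[of _ d M]) auto
  then obtain u where "u \<in> polys_in V" "eval_mpoly id a u = 1" "u * ?x ^ 0 \<in> I" using d by blast
  thus False using van[of u] by simp
qed

lemma no_zero_subset:
  assumes "no_zero UNIV" shows "no_zero V"
proof -
  have "no_zero (UNIV - Y)" if "finite Y" for Y
    using that
  proof (induction Y rule: finite_induct)
    case (insert n Y)
    hence "insert n (UNIV - insert n Y) = UNIV - Y" by auto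
    thus ?case using insert.IH no_zero_remove[of n "UNIV - insert n Y"] by simp
  qed (use assms in auto)
  from this[of "UNIV - V"] show ?thesis by (simp add: double_diff)
qed

text \<open>The radical of the ideal.\<close>

definition radical :: "('n, 'b) mpoly set" where "radical = {p. \<exists>k. p ^ k \<in> I}"

lemma radical_add: assumes "p \<in> radical" "q \<in> radical" shows "p + q \<in> radical"
proof -
  obtain k l where kl: "p ^ k \<in> I" "q ^ l \<in> I" using assms unfolding radical_def by blast
  have "(p + q) ^ (k + l) \<in> I"
    unfolding binomial_ring
  proof (intro sum)
    fix i assume "i \<in> {..k + l}"
    show "of_nat (k + l choose i) * p ^ i * q ^ (k + l - i) \<in> I"
    proof (cases "k \<le> i")
      case True
      hence "p ^ i = p ^ (i - k) * p ^ k" by (simp add: power_add[symmetric])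
      thus ?thesis
        using mult[OF kl(1), of "of_nat (k + l choose i) * p ^ (i - k) * q ^ (k + l - i)"] by (simp add: mult_ac)
    next
      case False
      hence "k + l - i = (k - i) + l" by simp
      hence "q ^ (k + l - i) = q ^ (k - i) * q ^ l" by (simp add: power_add)
      thus ?thesis
        using mult[OF kl(2), of "of_nat (k + l choose i) * p ^ i * q ^ (k - i)"] by (simp add: mult_ac)
    qed
  qed
  thus ?thesis unfolding radical_def by blast
qed

lemma radical_mult: "p \<in> radical \<Longrightarrow> q * p \<in> radical"
  unfolding radical_def using mult by (auto simp: power_mult_distrib)

lemma subset_radical: "p \<in> I \<Longrightarrow> p \<in> radical"
  unfolding radical_def by (intro CollectI exI[of _ 1]) simp

lemma radical_sum: "(\<And>a. a \<in> A \<Longrightarrow> f a \<in> radical) \<Longrightarrow> Groups_Big.sum f A \<in> radical"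
  by (induction A rule: infinite_finite_induct) (auto intro: radical_add subset_radical zero)

lemma radical_power: "p ^ k \<in> radical \<Longrightarrow> p \<in> radical"
  unfolding radical_def by (auto simp: power_mult[symmetric])

text \<open>By induction on \<open>V\<close>: the monic form \<open>f\<close> of degree \<open>d\<close> differs from the \<open>d\<close>-th power of the \<open>n\<close>-th
  indeterminate by monomials that are divisible by some indeterminate in \<open>V\<close>.\<close>

lemma var_in_radical:
  assumes "no_zero UNIV" shows "var_mpoly i \<in> radical"
proof -
  have "\<forall>i\<in>V. var_mpoly i \<in> radical" if "finite V" for V
    using that
  proof (induction V rule: finite_induct)
    case (insert n V)
    let ?x = "var_mpoly n :: ('n, 'b) mpoly"
    obtain f d where f: "f \<in> I" "f \<in> polys_in (insert n V)" "homogeneous d f"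
      and lf: "Poly_Mapping.lookup f (Poly_Mapping.single n d) = 1"
      using exists_monic[OF no_zero_subset[OF assms], of n "insert n V"] by blast
    have xd: "?x ^ d = Poly_Mapping.single (Poly_Mapping.single n d) 1"
      by (rule var_mpoly_power)
    define r where "r = ?x ^ d - f"
    have "(\<Sum>m\<in>Poly_Mapping.keys r. Poly_Mapping.single m (Poly_Mapping.lookup r m)) \<in> radical"
    proof (intro radical_sum)
      fix m assume m: "m \<in> Poly_Mapping.keys r"
      have ne: "m \<noteq> Poly_Mapping.single n d" using m lf by (auto simp: r_def in_keys_iff lookup_minus xd)
      hence mf: "m \<in> Poly_Mapping.keys f"
        using m by (auto simp: r_def in_keys_iff lookup_minus xd lookup_single when_def)
      have "\<exists>j\<in>V. Poly_Mapping.lookup m j \<noteq> 0"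
      proof (rule ccontr)
        assume "\<not> ?thesis"
        moreover have "Poly_Mapping.keys m \<subseteq> insert n V"
          using f(2) mf by (auto simp: polys_in_def)
        ultimately have "Poly_Mapping.lookup m j = 0" if "j \<noteq> n" for j
          using that by (metis in_keys_iff insert_iff subsetD)
        hence "m = Poly_Mapping.single n (Poly_Mapping.lookup m n)"
          by (intro poly_mapping_eqI) (auto simp: lookup_single when_def)
        moreover have "mdeg m = d" using f(3) mf by (auto simp: homogeneous_altdef)
        ultimately show False using ne by (metis mdeg_single)
      qed
      then obtain j where j: "j \<in> V" "Poly_Mapping.lookup m j \<noteq> 0" by blast
      let ?c = "Poly_Mapping.lookup r m"
      define b where "b = const_mpoly ?c * (\<Prod>i\<in>UNIV - {j}. var_mpoly i ^ Poly_Mapping.lookup m i)"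
      have "Poly_Mapping.single m ?c = b * var_mpoly j ^ Poly_Mapping.lookup m j"
        unfolding single_eq_prod_var b_def by (subst prod.remove[of _ j]) (auto simp: mult_ac)
      also obtain l where "Poly_Mapping.lookup m j = Suc l" using j(2) not0_implies_Suc by blast
      finally have "Poly_Mapping.single m ?c = (b * var_mpoly j ^ l) * var_mpoly j"
        by (simp add: mult_ac)
      thus "Poly_Mapping.single m ?c \<in> radical" using insert.IH j(1) radical_mult by metis
    qed
    hence "f + r \<in> radical" using radical_add[OF subset_radical[OF f(1)]] by (simp add: sum_single_lookup)
    hence "?x \<in> radical" using radical_power by (simp add: r_def)
    thus ?case using insert.IH by auto
  qed simp
  thus ?thesis by (metis UNIV_I finite)
qed

end

text \<open>The exponent \<open>M\<close> is the same for all indeterminates, and the cofactors are made homogeneous by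
  taking components of degree \<open>M\<close>.\<close>

theorem homogeneous_nullstellensatz:
  fixes \<Psi> :: "'n::finite \<Rightarrow> ('n, 'b::alg_closed_field) mpoly"
  assumes hom: "\<And>j. homogeneous D (\<Psi> j)" and nv: "nonvanishing \<Psi>"
  obtains M H where "M \<ge> D" "\<And>i j. homogeneous (M - D) (H i j)"
    "\<And>i. var_mpoly i ^ M = (\<Sum>j\<in>UNIV. H i j * \<Psi> j)"
proof -
  define I where "I = {p. \<exists>h. p = (\<Sum>j\<in>UNIV. h j * \<Psi> j)}"
  interpret homogeneous_ideal I
  proof
    show "0 \<in> I" unfolding I_def by (intro CollectI exI[of _ "\<lambda>_. 0"]) simp
    show "p + q \<in> I" if pq: "p \<in> I" "q \<in> I" for p q
    proof -
      obtain h k where "p = (\<Sum>j\<in>UNIV. h j * \<Psi> j)" "q = (\<Sum>j\<in>UNIV. k j * \<Psi> j)"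
        using pq unfolding I_def by blast
      thus ?thesis unfolding I_def
        by (intro CollectI exI[of _ "\<lambda>j. h j + k j"]) (simp add: distrib_right sum.distrib)
    qed
    show "q * p \<in> I" if p: "p \<in> I" for p q
    proof -
      obtain h where "p = (\<Sum>j\<in>UNIV. h j * \<Psi> j)" using p unfolding I_def by blast
      thus ?thesis unfolding I_def
        by (intro CollectI exI[of _ "\<lambda>j. q * h j"]) (simp add: sum_distrib_left mult_ac)
    qed
    show "hcomp d p \<in> I" if p: "p \<in> I" for p d
    proof -
      obtain h where "p = (\<Sum>j\<in>UNIV. h j * \<Psi> j)" using p unfolding I_def by blast
      thus ?thesis unfolding I_def
        by (auto simp: hcomp_sum hcomp_mult_homogeneous[OF hom])
    qed
  qed
  have \<Psi>I: "\<Psi> j \<in> I" for j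
  proof -
    have "(\<Sum>i\<in>UNIV. (if i = j then 1 else 0) * \<Psi> i) = (\<Sum>i\<in>UNIV. if i = j then \<Psi> i else 0)"
      by (intro Groups_Big.sum.cong) auto
    hence "\<Psi> j = (\<Sum>i\<in>UNIV. (if i = j then 1 else 0) * \<Psi> i)" by simp
    thus ?thesis unfolding I_def by (intro CollectI exI[of _ "\<lambda>i. if i = j then 1 else 0"])
  qed
  have "no_zero UNIV"
    unfolding no_zero_def using \<Psi>I nv by (auto simp: nonvanishing_def)
  hence "\<forall>i. \<exists>k. var_mpoly i ^ k \<in> I" using var_in_radical unfolding radical_def by blast
  then obtain k where k: "\<And>i. var_mpoly i ^ k i \<in> I" by metis
  define M where "M = D + (\<Sum>i\<in>UNIV. k i)"
  have "\<exists>h. (\<forall>j. homogeneous (M - D) (h j)) \<and> var_mpoly i ^ M = (\<Sum>j\<in>UNIV. h j * \<Psi> j)" for i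
  proof -
    have "k i \<le> M" unfolding M_def by (rule trans_le_add2, rule member_le_sum) auto
    hence "var_mpoly i ^ M = var_mpoly i ^ (M - k i) * (var_mpoly i :: ('n, 'b) mpoly) ^ k i"
      by (simp add: power_add[symmetric])
    hence "var_mpoly i ^ M \<in> I" using mult[OF k] by metis
    then obtain h where h: "var_mpoly i ^ M = (\<Sum>j\<in>UNIV. h j * \<Psi> j)" unfolding I_def by blast
    have "homogeneous (1 * M) (var_mpoly i ^ M :: ('n, 'b) mpoly)"
      by (intro homogeneous_power homogeneous_var)
    hence "var_mpoly i ^ M = hcomp M (var_mpoly i ^ M :: ('n, 'b) mpoly)"
      by (simp add: hcomp_homogeneous)
    also have "\<dots> = hcomp M (\<Sum>j\<in>UNIV. h j * \<Psi> j)" using h by (rule arg_cong)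
    also have "\<dots> = (\<Sum>j\<in>UNIV. hcomp (M - D) (h j) * \<Psi> j)"
      by (simp add: hcomp_sum hcomp_mult_homogeneous[OF hom] M_def)
    finally show ?thesis using homogeneous_hcomp
      by (intro exI[of _ "\<lambda>j. hcomp (M - D) (h j)"] conjI allI)
  qed
  then obtain H where "\<And>i j. homogeneous (M - D) (H i j)" "\<And>i. var_mpoly i ^ M = (\<Sum>j\<in>UNIV. H i j * \<Psi> j)"
    by metis
  thus thesis using that[of M H] by (simp add: M_def)
qed

section \<open>Subfields and subspaces\<close>

text \<open>Subfields, in terms of the operations of the type class. Since \<open>inverse 0 = 0\<close>, closure under
  \<open>inverse\<close> needs no exception for zero.\<close>

definition is_subfield :: "'b::field set \<Rightarrow> bool" where
  "is_subfield L \<longleftrightarrow> 0 \<in> L \<and> 1 \<in> L \<and> (\<forall>a\<in>L. \<forall>b\<in>L. a + b \<in> L \<and> a * b \<in> L) \<and> (\<forall>a\<in>L. - a \<in> L \<and> inverse a \<in> L)"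

lemma is_subfieldD:
  assumes "is_subfield L"
  shows "0 \<in> L" "1 \<in> L" "a \<in> L \<Longrightarrow> b \<in> L \<Longrightarrow> a + b \<in> L" "a \<in> L \<Longrightarrow> b \<in> L \<Longrightarrow> a * b \<in> L"
    "a \<in> L \<Longrightarrow> - a \<in> L" "a \<in> L \<Longrightarrow> inverse a \<in> L" "a \<in> L \<Longrightarrow> b \<in> L \<Longrightarrow> a - b \<in> L"
proof -
  show "a - b \<in> L" if "a \<in> L" "b \<in> L"
    using assms that unfolding is_subfield_def by (metis add_uminus_conv_diff)
qed (use assms in \<open>auto simp: is_subfield_def\<close>)

lemma is_subfield_sum: "is_subfield L \<Longrightarrow> (\<And>a. a \<in> A \<Longrightarrow> f a \<in> L) \<Longrightarrow> sum f A \<in> L"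
  by (induction A rule: infinite_finite_induct) (auto simp: is_subfieldD)

lemma is_subfield_prod: "is_subfield L \<Longrightarrow> (\<And>a. a \<in> A \<Longrightarrow> f a \<in> L) \<Longrightarrow> prod f A \<in> L"
  by (induction A rule: infinite_finite_induct) (auto simp: is_subfieldD)

lemma is_subfield_power: "is_subfield L \<Longrightarrow> a \<in> L \<Longrightarrow> a ^ n \<in> L"
  by (induction n) (auto simp: is_subfieldD)

lemma eval_in_subfield:
  assumes "is_subfield L" "\<And>m. Poly_Mapping.lookup p m \<in> L" "\<And>i. x i \<in> L"
  shows "eval_mpoly id x p \<in> L"
  unfolding eval_mpoly_def
  by (intro is_subfield_sum is_subfieldD(4) is_subfield_prod is_subfield_power assms) (simp add: assms)

text \<open>Polynomials with all coefficients in \<open>L\<close>.\<close>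

definition coeffs_in :: "'b::field set \<Rightarrow> ('n, 'b) mpoly set" where
  "coeffs_in L = {p. \<forall>m. Poly_Mapping.lookup p m \<in> L}"

lemma coeffs_in_sum:
  "is_subfield L \<Longrightarrow> (\<And>a. a \<in> A \<Longrightarrow> f a \<in> coeffs_in L) \<Longrightarrow> sum f A \<in> coeffs_in L"
  by (auto simp: coeffs_in_def lookup_sum intro: is_subfield_sum)

lemma coeffs_in_single: "is_subfield L \<Longrightarrow> c \<in> L \<Longrightarrow> Poly_Mapping.single m c \<in> coeffs_in L"
  by (auto simp: coeffs_in_def lookup_single when_def is_subfieldD)

lemma coeffs_in_mult:
  fixes p :: "('n::finite, 'b::field) mpoly"
  assumes "is_subfield L" "p \<in> coeffs_in L" "q \<in> coeffs_in L" shows "p * q \<in> coeffs_in L"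
  using assms unfolding mult_eq_sum_single[of p q]
  by (intro coeffs_in_sum coeffs_in_single is_subfieldD(4)) (auto simp: coeffs_in_def)

lemma coeffs_in_1: "is_subfield L \<Longrightarrow> 1 \<in> coeffs_in L"
  by (simp add: single_one[symmetric] coeffs_in_single is_subfieldD del: single_one)

lemma coeffs_in_var: "is_subfield L \<Longrightarrow> var_mpoly i \<in> coeffs_in L"
  by (simp add: var_mpoly_def coeffs_in_single is_subfieldD)

lemma coeffs_in_const: "is_subfield L \<Longrightarrow> c \<in> L \<Longrightarrow> const_mpoly c \<in> coeffs_in L"
  by (simp add: const_mpoly_def coeffs_in_single)

lemma coeffs_in_power:
  fixes p :: "('n::finite, 'b::field) mpoly"
  shows "is_subfield L \<Longrightarrow> p \<in> coeffs_in L \<Longrightarrow> p ^ k \<in> coeffs_in L"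
  by (induction k) (auto simp: coeffs_in_1 coeffs_in_mult)

lemma coeffs_in_prod:
  fixes f :: "'i \<Rightarrow> ('n::finite, 'b::field) mpoly"
  shows "is_subfield L \<Longrightarrow> (\<And>a. a \<in> A \<Longrightarrow> f a \<in> coeffs_in L) \<Longrightarrow> prod f A \<in> coeffs_in L"
  by (induction A rule: infinite_finite_induct) (auto simp: coeffs_in_1 coeffs_in_mult)

lemma coeffs_in_comp:
  assumes "is_subfield L" "\<And>i. F i \<in> coeffs_in L" "\<And>i. G i \<in> coeffs_in L"
  shows "mor_comp F G i \<in> coeffs_in L"
  unfolding mor_comp_def eval_mpoly_def using assms
  by (intro coeffs_in_sum coeffs_in_mult coeffs_in_const coeffs_in_prod coeffs_in_power)
    (auto simp: coeffs_in_def)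

lemma coeffs_in_iterate:
  assumes "is_subfield L" "\<And>i. F i \<in> coeffs_in L"
  shows "mor_iterate F r i \<in> coeffs_in L"
  using assms by (induction r arbitrary: i) (auto simp: mor_iterate_Suc coeffs_in_var intro!: coeffs_in_comp)

text \<open>Linear subspaces over \<open>L\<close> of the ambient field.\<close>

definition subsp :: "'b::field set \<Rightarrow> 'b set \<Rightarrow> bool" where
  "subsp L U \<longleftrightarrow> 0 \<in> U \<and> (\<forall>u\<in>U. \<forall>v\<in>U. u + v \<in> U) \<and> (\<forall>c\<in>L. \<forall>u\<in>U. c * u \<in> U)"

lemma subspD:
  assumes "subsp L U"
  shows "0 \<in> U" "u \<in> U \<Longrightarrow> v \<in> U \<Longrightarrow> u + v \<in> U" "c \<in> L \<Longrightarrow> u \<in> U \<Longrightarrow> c * u \<in> U"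
  using assms by (auto simp: subsp_def)

lemma subsp_diff: "is_subfield L \<Longrightarrow> subsp L U \<Longrightarrow> u \<in> U \<Longrightarrow> v \<in> U \<Longrightarrow> u - v \<in> U"
  using subspD(2)[of L U u "- v"] subspD(3)[of L U "- 1" v] is_subfieldD(2,5)[of L] by simp

lemma subsp_sum: "subsp L U \<Longrightarrow> (\<And>a. a \<in> A \<Longrightarrow> f a \<in> U) \<Longrightarrow> sum f A \<in> U"
  by (induction A rule: infinite_finite_induct) (auto simp: subspD)

text \<open>The linear span over \<open>L\<close>.\<close>

definition lspan :: "'b::field set \<Rightarrow> 'b set \<Rightarrow> 'b set" where
  "lspan L S = \<Inter> {U. subsp L U \<and> S \<subseteq> U}"

lemma subsp_lspan: "subsp L (lspan L S)"
  unfolding lspan_def by (auto simp: subsp_def)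

lemma lspan_superset: "S \<subseteq> lspan L S"
  by (auto simp: lspan_def)

lemma lspan_minimal: "subsp L U \<Longrightarrow> S \<subseteq> U \<Longrightarrow> lspan L S \<subseteq> U"
  by (auto simp: lspan_def)

lemma lspan_mono: "S \<subseteq> T \<Longrightarrow> lspan L S \<subseteq> lspan L T"
  by (auto simp: lspan_def)

lemma lspan_mult:
  assumes U: "subsp L U" and ST: "\<And>a b. a \<in> S \<Longrightarrow> b \<in> T \<Longrightarrow> a * b \<in> U"
    and "x \<in> lspan L S" "y \<in> lspan L T"
  shows "x * y \<in> U"
proof -
  have "subsp L {a. \<forall>b\<in>T. a * b \<in> U}"
    using U unfolding subsp_def by (auto simp: distrib_right mult.assoc)
  hence "lspan L S \<subseteq> {a. \<forall>b\<in>T. a * b \<in> U}" using ST by (intro lspan_minimal) auto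
  hence *: "\<forall>b\<in>T. x * b \<in> U" using assms(3) by auto
  have "subsp L {b. x * b \<in> U}"
    using U unfolding subsp_def by (auto simp: distrib_left mult.left_commute)
  hence "lspan L T \<subseteq> {b. x * b \<in> U}" using * by (intro lspan_minimal) auto
  thus ?thesis using assms(4) by auto
qed

lemma lspan_finite_support:
  assumes "c \<in> lspan L S"
  obtains T where "finite T" "T \<subseteq> S" "c \<in> lspan L T"
proof -
  let ?U = "{c. \<exists>T. finite T \<and> T \<subseteq> S \<and> c \<in> lspan L T}"
  have "subsp L ?U"
    unfolding subsp_def
  proof (intro conjI ballI)
    show "0 \<in> ?U" using subspD(1)[OF subsp_lspan] by (intro CollectI exI[of _ "{}"]) auto
    fix u v assume "u \<in> ?U" "v \<in> ?U"
    then obtain T T' where "finite T" "T \<subseteq> S" "u \<in> lspan L T" "finite T'" "T' \<subseteq> S" "v \<in> lspan L T'"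
      by blast
    moreover from this have "u \<in> lspan L (T \<union> T')" "v \<in> lspan L (T \<union> T')"
      using lspan_mono[of T "T \<union> T'" L] lspan_mono[of T' "T \<union> T'" L] by auto
    ultimately show "u + v \<in> ?U"
      using subspD(2)[OF subsp_lspan] by (intro CollectI exI[of _ "T \<union> T'"]) auto
  next
    fix c u assume "c \<in> L" "u \<in> ?U"
    thus "c * u \<in> ?U" using subspD(3)[OF subsp_lspan] by blast
  qed
  moreover have "S \<subseteq> ?U"
  proof
    fix s assume "s \<in> S"
    thus "s \<in> ?U" using lspan_superset[of "{s}" L] by (intro CollectI exI[of _ "{s}"]) auto
  qed
  ultimately have "lspan L S \<subseteq> ?U" by (rule lspan_minimal)
  thus thesis using assms that by blast
qed

section \<open>A linear projection onto a subfield\<close>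

text \<open>A subspace \<open>U\<close> maximal among those not containing \<open>1\<close> is a complement of \<open>L\<close>, and \<open>\<pi>\<close> is the
  projection along \<open>U\<close>.\<close>

lemma exists_linear_projection:
  fixes L :: "'b::field set"
  assumes L: "is_subfield L"
  obtains \<pi> :: "'b \<Rightarrow> 'b" where "\<And>x y. \<pi> (x + y) = \<pi> x + \<pi> y"
    "\<And>c x. c \<in> L \<Longrightarrow> \<pi> (c * x) = c * \<pi> x" "\<pi> 1 = 1" "\<And>x. \<pi> x \<in> L"
proof -
  note LD = is_subfieldD[OF L]
  let ?A = "{U. subsp L U \<and> 1 \<notin> U}"
  have "\<exists>M\<in>?A. \<forall>Y\<in>?A. M \<subseteq> Y \<longrightarrow> Y = M"
  proof (rule subset_Zorn_nonempty)
    have "{0} \<in> ?A" by (auto simp: subsp_def)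
    thus "?A \<noteq> {}" by blast
    fix C assume C: "C \<noteq> {}" "subset.chain ?A C"
    hence sub: "\<And>U. U \<in> C \<Longrightarrow> subsp L U" "\<And>U. U \<in> C \<Longrightarrow> 1 \<notin> U"
      and tot: "\<And>U W. U \<in> C \<Longrightarrow> W \<in> C \<Longrightarrow> U \<subseteq> W \<or> W \<subseteq> U"
      by (auto simp: subset_chain_def)
    have "subsp L (\<Union>C)"
      unfolding subsp_def
    proof (intro conjI ballI)
      show "0 \<in> \<Union>C" using C(1) subspD(1)[OF sub(1)] by blast
      fix u v assume "u \<in> \<Union>C" "v \<in> \<Union>C"
      then obtain U W where "U \<in> C" "u \<in> U" "W \<in> C" "v \<in> W" by blast
      then obtain Z where "Z \<in> C" "u \<in> Z" "v \<in> Z" using tot by blast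
      thus "u + v \<in> \<Union>C" using subspD(2)[OF sub(1)] by blast
    next
      fix c u assume "c \<in> L" "u \<in> \<Union>C"
      thus "c * u \<in> \<Union>C" using subspD(3)[OF sub(1)] by blast
    qed
    thus "\<Union>C \<in> ?A" using sub(2) by blast
  qed
  then obtain U where U: "subsp L U" "1 \<notin> U"
    and max: "\<And>Y. subsp L Y \<Longrightarrow> 1 \<notin> Y \<Longrightarrow> U \<subseteq> Y \<Longrightarrow> Y = U" by blast
  have ex: "\<exists>c\<in>L. x - c \<in> U" for x
  proof (cases "x \<in> U")
    case True thus ?thesis using LD(1) by (intro bexI[of _ 0]) auto
  next
    case False
    define W where "W = {u + c * x | u c. u \<in> U \<and> c \<in> L}"
    have "subsp L W"
      unfolding subsp_def
    proof (intro conjI ballI)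
      show "0 \<in> W" using subspD(1)[OF U(1)] LD(1) unfolding W_def by force
      fix a b assume "a \<in> W" "b \<in> W"
      then obtain u c v e where "a = u + c * x" "b = v + e * x" "u \<in> U" "v \<in> U" "c \<in> L" "e \<in> L"
        unfolding W_def by blast
      thus "a + b \<in> W" unfolding W_def using subspD(2)[OF U(1)] LD(3)
        by (intro CollectI exI[of _ "u + v"] exI[of _ "c + e"]) (auto simp: algebra_simps)
    next
      fix e a assume e: "e \<in> L" and "a \<in> W"
      then obtain u c where "a = u + c * x" "u \<in> U" "c \<in> L" unfolding W_def by blast
      thus "e * a \<in> W" unfolding W_def using subspD(3)[OF U(1)] LD(4) e
        by (intro CollectI exI[of _ "e * u"] exI[of _ "e * c"]) (auto simp: algebra_simps)
    qed
    moreover have "U \<subseteq> W" unfolding W_def using LD(1) by force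
    moreover have "x \<in> W" unfolding W_def using LD(2) subspD(1)[OF U(1)] by force
    ultimately have "1 \<in> W" using max[of W] False by blast
    then obtain u c where uc: "1 = u + c * x" "u \<in> U" "c \<in> L" unfolding W_def by blast
    have c: "c \<noteq> 0" using uc U(2) by auto
    have "c * x = 1 - u" using uc(1) by (simp add: algebra_simps)
    hence "inverse c * (c * x) = inverse c * (1 - u)" by simp
    hence "x = inverse c * (1 - u)" using c by (simp only: mult.assoc[symmetric]) simp
    hence "x - inverse c = (- inverse c) * u" by (simp add: algebra_simps)
    also have "\<dots> \<in> U" using uc LD by (intro subspD(3)[OF U(1)]) auto
    finally show ?thesis using uc(3) LD(6) by blast
  qed
  have uniq: "c = c'" if "c \<in> L" "c' \<in> L" "x - c \<in> U" "x - c' \<in> U" for c c' x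
  proof (rule ccontr)
    assume ne: "c \<noteq> c'"
    have "c - c' \<in> U" using subsp_diff[OF L U(1) that(4,3)] by simp
    hence "inverse (c - c') * (c - c') \<in> U" using that LD by (intro subspD(3)[OF U(1)]) auto
    thus False using U(2) ne by simp
  qed
  from ex obtain \<pi> where \<pi>: "\<And>x. \<pi> x \<in> L" "\<And>x. x - \<pi> x \<in> U" by metis
  show thesis
  proof (rule that[of \<pi>])
    show "\<pi> (x + y) = \<pi> x + \<pi> y" for x y
    proof (rule uniq[of _ _ "x + y"])
      have "(x - \<pi> x) + (y - \<pi> y) \<in> U" using \<pi> by (intro subspD(2)[OF U(1)])
      thus "x + y - (\<pi> x + \<pi> y) \<in> U" by (simp add: algebra_simps)
    qed (use \<pi> LD in auto)
    show "\<pi> (c * x) = c * \<pi> x" if "c \<in> L" for c x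
    proof (rule uniq[of _ _ "c * x"])
      have "c * (x - \<pi> x) \<in> U" using \<pi> that by (intro subspD(3)[OF U(1)])
      thus "c * x - c * \<pi> x \<in> U" by (simp add: algebra_simps)
    qed (use \<pi> LD that in auto)
    show "\<pi> 1 = 1"
      by (rule uniq[of _ _ 1]) (use \<pi> LD subspD(1)[OF U(1)] in auto)
  qed (rule \<pi>)
qed

section \<open>Coefficients of a polynomial from its values\<close>

lemma infinite_exists_power_ne:
  assumes "infinite (L :: 'b::field set)" "a \<noteq> (b::nat)"
  shows "\<exists>t\<in>L. t ^ a \<noteq> t ^ b"
proof (rule ccontr)
  assume "\<not> ?thesis"
  hence "L \<subseteq> {t. poly (Polynomial.monom 1 a - Polynomial.monom 1 b) t = 0}"
    by (auto simp: poly_monom)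
  moreover have "Polynomial.coeff (Polynomial.monom 1 a - Polynomial.monom 1 b :: 'b poly) a \<noteq> 0"
    using assms(2) by simp
  hence "Polynomial.monom 1 a - Polynomial.monom 1 b \<noteq> (0 :: 'b poly)" by fastforce
  ultimately show False using assms(1) poly_roots_finite finite_subset by metis
qed

text \<open>
  If all values of a polynomial at points over an infinite field \<open>L\<close> lie in an \<open>L\<close>-subspace \<open>U\<close>, then so do
  its coefficients. The monomials are pairwise distinct multiplicative functions on these points,
  and Dedekind's proof of the independence of characters applies modulo \<open>U\<close>. In particular, no
  bound on the degrees is needed.
\<close>

lemma coefficients_in_subspace:
  fixes L U :: "'b::field set" and S :: "('n::finite \<Rightarrow>\<^sub>0 nat) set"
  defines "mv \<equiv> \<lambda>(m :: 'n \<Rightarrow>\<^sub>0 nat) (x :: 'n \<Rightarrow> 'b). \<Prod>i\<in>UNIV. x i ^ Poly_Mapping.lookup m i"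
  assumes L: "is_subfield L" "infinite L" and U: "subsp L U" and "finite S"
    and "\<And>x. (\<forall>i. x i \<in> L) \<Longrightarrow> (\<Sum>m\<in>S. c m * mv m x) \<in> U"
    and "m \<in> S"
  shows "c m \<in> U"
  using assms(5-7)
proof (induction S arbitrary: c m rule: finite_induct)
  case (insert m0 S)
  have mv_mult: "mv m (\<lambda>i. x i * y i) = mv m x * mv m y" for m x y
    by (simp add: mv_def power_mult_distrib prod.distrib)
  have mv_in: "mv m x \<in> L" if "\<forall>i. x i \<in> L" for m x
    unfolding mv_def using that by (intro is_subfield_prod is_subfield_power L) auto
  have inS: "c m \<in> U" if m: "m \<in> S" for m
  proof -
    have "m \<noteq> m0" using m insert.hyps by auto
    then obtain i where i: "Poly_Mapping.lookup m i \<noteq> Poly_Mapping.lookup m0 i"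
      by (metis poly_mapping_eqI)
    obtain t where t: "t \<in> L" "t ^ Poly_Mapping.lookup m i \<noteq> t ^ Poly_Mapping.lookup m0 i"
      using infinite_exists_power_ne[OF L(2) i] by blast
    define y where "y = (\<lambda>j. if j = i then t else 1)"
    have yL: "\<forall>j. y j \<in> L" using t is_subfieldD[OF L(1)] by (auto simp: y_def)
    have mvy: "mv m' y = t ^ Poly_Mapping.lookup m' i" for m'
    proof -
      have "mv m' y = (\<Prod>j\<in>UNIV. if j = i then t ^ Poly_Mapping.lookup m' j else 1)"
        unfolding mv_def y_def by (intro prod.cong) auto
      thus ?thesis by simp
    qed
    have "c m * (mv m y - mv m0 y) \<in> U"
    proof (rule insert.IH[OF _ m])
      fix x :: "'n \<Rightarrow> 'b" assume x: "\<forall>i. x i \<in> L"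
      have "(\<Sum>m\<in>S. c m * (mv m y - mv m0 y) * mv m x)
          = (\<Sum>m\<in>insert m0 S. c m * (mv m y - mv m0 y) * mv m x)"
        using insert.hyps by simp
      also have "\<dots> = (\<Sum>m\<in>insert m0 S. c m * mv m (\<lambda>i. x i * y i))
          - mv m0 y * (\<Sum>m\<in>insert m0 S. c m * mv m x)"
        unfolding sum_distrib_left sum_subtractf[symmetric] by (intro sum.cong) (auto simp: mv_mult algebra_simps)
      also have "\<dots> \<in> U"
        by (rule subsp_diff[OF L(1) U]; (intro subspD(3)[OF U])?; (intro insert.prems(1) mv_in)?)
          (use x yL is_subfieldD(4)[OF L(1)] in auto)
      finally show "(\<Sum>m\<in>S. c m * (mv m y - mv m0 y) * mv m x) \<in> U" .
    qed
    moreover have ne: "mv m y - mv m0 y \<noteq> 0" using t(2) by (simp add: mvy)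
    moreover have "mv m y - mv m0 y \<in> L" by (intro is_subfieldD(7)[OF L(1)] mv_in yL)
    ultimately have "inverse (mv m y - mv m0 y) * (c m * (mv m y - mv m0 y)) \<in> U"
      using subspD(3)[OF U is_subfieldD(6)[OF L(1)]] by blast
    thus ?thesis using ne by (simp only: mult.left_commute[of _ "c m"]) simp
  qed
  show ?case
  proof (cases "m = m0")
    case True
    have mv1: "mv m (\<lambda>_. 1) = 1" for m by (simp add: mv_def)
    have "(\<Sum>m\<in>insert m0 S. c m * mv m (\<lambda>_. 1)) \<in> U"
      using is_subfieldD(2)[OF L(1)] by (intro insert.prems(1)) auto
    moreover have "(\<Sum>m\<in>S. c m) \<in> U" using inS by (rule subsp_sum[OF U])
    ultimately have "(\<Sum>m\<in>insert m0 S. c m) - (\<Sum>m\<in>S. c m) \<in> U"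
      using subsp_diff[OF L(1) U] by (simp add: mv1)
    thus ?thesis using insert.hyps True by simp
  qed (use inS insert.prems in auto)
qed simp

section \<open>Descent of the Nullstellensatz to a subfield\<close>

lemma lookup_map_0: "f 0 = 0 \<Longrightarrow> Poly_Mapping.lookup (Poly_Mapping.map f p) m = f (Poly_Mapping.lookup p m)"
  by (simp add: map.rep_eq when_def)

text \<open>A linear projection \<open>\<pi>\<close> of the ambient field onto \<open>L\<close>, applied to coefficients, is linear over the
  polynomials with coefficients in \<open>L\<close>. It therefore maps a representation of a power of an
  indeterminate to one over \<open>L\<close>. The field \<open>L\<close> itself need not be algebraically closed.\<close>

theorem nullstellensatz_over_subfield:
  fixes \<Psi> :: "'n::finite \<Rightarrow> ('n, 'b::alg_closed_field) mpoly"
  assumes L: "is_subfield L" and hom: "\<And>j. homogeneous D (\<Psi> j)"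
    and nv: "nonvanishing \<Psi>" and co: "\<And>j. \<Psi> j \<in> coeffs_in L"
  obtains M H where "M \<ge> D" "\<And>i j. homogeneous (M - D) (H i j)" "\<And>i j. H i j \<in> coeffs_in L"
    "\<And>i. var_mpoly i ^ M = (\<Sum>j\<in>UNIV. H i j * \<Psi> j)"
proof -
  obtain M H where M: "M \<ge> D" and H: "\<And>i j. homogeneous (M - D) (H i j)"
    and eq: "\<And>i. var_mpoly i ^ M = (\<Sum>j\<in>UNIV. H i j * \<Psi> j)"
    using homogeneous_nullstellensatz[OF hom nv] by metis
  obtain \<pi> :: "'b \<Rightarrow> 'b" where \<pi>: "\<And>x y. \<pi> (x + y) = \<pi> x + \<pi> y"
    "\<And>c x. c \<in> L \<Longrightarrow> \<pi> (c * x) = c * \<pi> x" "\<pi> 1 = 1" "\<And>x. \<pi> x \<in> L"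
    using exists_linear_projection[OF L] by metis
  have \<pi>0: "\<pi> 0 = 0" using \<pi>(1)[of 0 0] by (metis add.right_neutral add_left_cancel)
  define P :: "('n, 'b) mpoly \<Rightarrow> ('n, 'b) mpoly" where "P = Poly_Mapping.map \<pi>"
  have lP: "Poly_Mapping.lookup (P p) m = \<pi> (Poly_Mapping.lookup p m)" for p m
    by (simp add: P_def lookup_map_0 \<pi>0)
  have \<pi>_sum: "\<pi> (sum f A) = (\<Sum>a\<in>A. \<pi> (f a))" for f and A :: "'z set"
    by (induction A rule: infinite_finite_induct) (auto simp: \<pi> \<pi>0)
  have P_sum: "P (sum f A) = (\<Sum>a\<in>A. P (f a))" for f and A :: "'z set"
    by (rule poly_mapping_eqI) (simp add: lP lookup_sum \<pi>_sum)
  have P_single: "P (Poly_Mapping.single m c) = Poly_Mapping.single m (\<pi> c)" for m c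
    by (rule poly_mapping_eqI) (simp add: lP lookup_single when_def \<pi>0)
  have P_mult: "P (p * q) = P p * q" if q: "q \<in> coeffs_in L" for p q
  proof -
    have "P p = (\<Sum>m\<in>Poly_Mapping.keys p. Poly_Mapping.single m (\<pi> (Poly_Mapping.lookup p m)))"
      by (subst sum_single_lookup[of p, symmetric]) (simp only: P_sum P_single)
    hence "P p * q = (\<Sum>m\<in>Poly_Mapping.keys p. \<Sum>m'\<in>Poly_Mapping.keys q.
        Poly_Mapping.single (m + m') (\<pi> (Poly_Mapping.lookup p m) * Poly_Mapping.lookup q m'))"
      by (subst sum_single_lookup[of q, symmetric]) (simp add: sum_product mult_single)
    moreover have "\<pi> (Poly_Mapping.lookup p m * Poly_Mapping.lookup q m')
        = \<pi> (Poly_Mapping.lookup p m) * Poly_Mapping.lookup q m'" for m m'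
      using \<pi>(2)[of "Poly_Mapping.lookup q m'"] q by (simp add: coeffs_in_def mult.commute)
    ultimately show ?thesis
      by (subst mult_eq_sum_single) (simp only: P_sum P_single)
  qed
  have P1: "P 1 = 1" using P_single[of 0 1] by (simp add: \<pi>)
  show thesis
  proof (rule that[OF M, of "\<lambda>i j. P (H i j)"])
    show "homogeneous (M - D) (P (H i j))" for i j
      using H[of i j] \<pi>0 by (fastforce simp: homogeneous_altdef in_keys_iff lP)
    show "P (H i j) \<in> coeffs_in L" for i j
      using \<pi> by (simp add: coeffs_in_def lP)
    fix i
    have "var_mpoly i ^ M \<in> (coeffs_in L :: ('n, 'b) mpoly set)"
      by (intro coeffs_in_power coeffs_in_var L)
    hence "var_mpoly i ^ M = P (var_mpoly i ^ M)"
      using P_mult[of "var_mpoly i ^ M" 1] P1 by simp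
    also have "\<dots> = (\<Sum>j\<in>UNIV. P (H i j) * \<Psi> j)"
      unfolding eq P_sum by (intro sum.cong refl P_mult co)
    finally show "var_mpoly i ^ M = (\<Sum>j\<in>UNIV. P (H i j) * \<Psi> j)" .
  qed
qed

section \<open>The filtration of a finitely generated algebra by degree\<close>

context
  fixes L T :: "'b::field set"
  assumes L: "is_subfield L" and T: "finite T"
begin

text \<open>The monomial with exponents \<open>e\<close>, evaluated at the generators in \<open>T\<close>.\<close>

definition monomial_at :: "('b \<Rightarrow> nat) \<Rightarrow> 'b" where
  "monomial_at e = (\<Prod>t\<in>T. t ^ e t)"

text \<open>The values of all polynomials over \<open>L\<close> of degree at most \<open>k\<close> at the generators in \<open>T\<close>.\<close>

definition filtration :: "nat \<Rightarrow> 'b set" where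
  "filtration k = lspan L {monomial_at e | e. sum e T \<le> k}"

lemma subsp_filtration: "subsp L (filtration k)" unfolding filtration_def by (rule subsp_lspan)

lemma filtration_mono: "k \<le> l \<Longrightarrow> filtration k \<subseteq> filtration l"
  unfolding filtration_def by (rule lspan_mono) auto

lemma filtration_monomial: "sum e T \<le> k \<Longrightarrow> monomial_at e \<in> filtration k"
  unfolding filtration_def by (rule subsetD[OF lspan_superset]) blast

lemma filtration_one: "1 \<in> filtration k"
  using filtration_monomial[of "\<lambda>_. 0" k] by (simp add: monomial_at_def)

lemma filtration_generator: "t \<in> T \<Longrightarrow> t \<in> filtration 1"
proof -
  assume t: "t \<in> T"
  let ?e = "\<lambda>s. if s = t then 1 else 0 :: nat"
  have "monomial_at ?e = (\<Prod>s\<in>T. if s = t then s else 1)"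
    unfolding monomial_at_def by (intro prod.cong) auto
  hence "monomial_at ?e = t" using t T by simp
  thus ?thesis using filtration_monomial[of ?e 1] t T by simp
qed

lemma lspan_subset_filtration: "lspan L T \<subseteq> filtration 1"
  by (intro lspan_minimal[OF subsp_filtration] subsetI filtration_generator)

lemma filtration_mult: "x \<in> filtration k \<Longrightarrow> y \<in> filtration l \<Longrightarrow> x * y \<in> filtration (k + l)"
proof -
  assume xy: "x \<in> filtration k" "y \<in> filtration l"
  show ?thesis
  proof (rule lspan_mult[OF subsp_filtration _ xy[unfolded filtration_def]])
    fix a b assume "a \<in> {monomial_at e |e. sum e T \<le> k}" "b \<in> {monomial_at e |e. sum e T \<le> l}"
    then obtain e f where "a = monomial_at e" "sum e T \<le> k" "b = monomial_at f" "sum f T \<le> l" by blast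
    moreover have "monomial_at e * monomial_at f = monomial_at (\<lambda>t. e t + f t)"
      by (simp add: monomial_at_def power_add prod.distrib)
    ultimately show "a * b \<in> filtration (k + l)"
      using filtration_monomial[of "\<lambda>t. e t + f t" "k + l"] by (simp add: sum.distrib)
  qed
qed

lemma filtration_power: "x \<in> filtration k \<Longrightarrow> x ^ n \<in> filtration (k * n)"
  by (induction n) (auto simp: filtration_one intro: filtration_mult)

lemma filtration_prod: "finite A \<Longrightarrow> (\<And>a. a \<in> A \<Longrightarrow> f a \<in> filtration (g a)) \<Longrightarrow> prod f A \<in> filtration (sum g A)"
  by (induction A rule: finite_induct) (auto simp: filtration_one intro: filtration_mult)

lemma eval_homogeneous_in_filtration:
  assumes "homogeneous d p" "p \<in> coeffs_in L" "\<And>i. w i \<in> filtration 1"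
  shows "eval_mpoly id w p \<in> filtration d"
  unfolding eval_mpoly_def
proof (rule subsp_sum[OF subsp_filtration])
  fix m assume m: "m \<in> Poly_Mapping.keys p"
  have "w i ^ Poly_Mapping.lookup m i \<in> filtration (Poly_Mapping.lookup m i)" for i
    using filtration_power[OF assms(3)[of i]] by simp
  hence "(\<Prod>i\<in>UNIV. w i ^ Poly_Mapping.lookup m i) \<in> filtration (\<Sum>i\<in>UNIV. Poly_Mapping.lookup m i)"
    by (intro filtration_prod) auto
  moreover have "(\<Sum>i\<in>UNIV. Poly_Mapping.lookup m i) = d" using assms(1) m by (simp add: homogeneous_def)
  ultimately show "id (Poly_Mapping.lookup p m) * (\<Prod>i\<in>UNIV. w i ^ Poly_Mapping.lookup m i) \<in> filtration d"
    using assms(2) by (intro subspD(3)[OF subsp_filtration]) (auto simp: coeffs_in_def)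
qed

text \<open>A monomial of degree greater than \<open>card T * M\<close> contains the \<open>M\<close>-th power of some generator, and
  can be rewritten in lower degree.\<close>

lemma filtration_stabilises:
  assumes M: "M \<ge> 1" and int: "\<And>t. t \<in> T \<Longrightarrow> t ^ M \<in> filtration (M - 1)"
  shows "filtration k \<subseteq> filtration (card T * M)"
proof (induction k)
  case 0 show ?case by (rule filtration_mono) simp
next
  case (Suc k)
  show ?case
    unfolding filtration_def[of "Suc k"]
  proof (rule lspan_minimal[OF subsp_filtration], safe)
    fix e assume e: "sum e T \<le> Suc k"
    show "monomial_at e \<in> filtration (card T * M)"
    proof (cases "sum e T \<le> k \<or> Suc k \<le> card T * M")
      case True
      thus ?thesis using e Suc.IH filtration_monomial by (meson le_trans subsetD)
    next
      case False
      hence s: "sum e T = Suc k" "sum e T > card T * M" using e by auto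
      have "\<exists>t\<in>T. e t \<ge> M"
      proof (rule ccontr)
        assume "\<not> ?thesis"
        hence "sum e T \<le> card T * M" using sum_bounded_above[of T e M] by fastforce
        thus False using s by simp
      qed
      then obtain t where t: "t \<in> T" "e t \<ge> M" by blast
      define f where "f = e(t := e t - M)"
      have ts: "T = insert t (T - {t})" using t by auto
      have fs: "sum f (T - {t}) = sum e (T - {t})" "(\<Prod>s\<in>T - {t}. s ^ f s) = (\<Prod>s\<in>T - {t}. s ^ e s)"
        by (auto simp: f_def intro!: sum.cong prod.cong)
      have sf: "sum f T + M = sum e T"
        using t T by (simp add: sum.remove[OF T t(1)] fs) (simp add: f_def)
      have "monomial_at e = t ^ M * monomial_at f"
        using t by (simp add: monomial_at_def prod.remove[OF T t(1)] fs)
          (simp add: f_def power_add[symmetric] mult.assoc[symmetric])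
      moreover have "t ^ M * monomial_at f \<in> filtration (M - 1 + sum f T)"
        by (intro filtration_mult int t filtration_monomial) simp
      moreover have "M - 1 + sum f T = k" using sf s M by linarith
      ultimately have "monomial_at e \<in> filtration k" by simp
      thus ?thesis using Suc.IH by blast
    qed
  qed
qed

lemma filtration_finitely_generated: "\<exists>G. finite G \<and> filtration k = lspan L G"
proof -
  have "{monomial_at e | e. sum e T \<le> k} \<subseteq> monomial_at ` (T \<rightarrow>\<^sub>E {..k})"
  proof safe
    fix e assume e: "sum e T \<le> k"
    have "e t \<le> k" if "t \<in> T" for t using member_le_sum[OF that _ T, of e] e by simp
    hence "restrict e T \<in> T \<rightarrow>\<^sub>E {..k}" by auto
    moreover have "monomial_at e = monomial_at (restrict e T)" by (simp add: monomial_at_def)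
    ultimately show "monomial_at e \<in> monomial_at ` (T \<rightarrow>\<^sub>E {..k})" by blast
  qed
  moreover have "finite (monomial_at ` (T \<rightarrow>\<^sub>E {..k}))" using T by (intro finite_imageI finite_PiE) auto
  ultimately have "finite {monomial_at e | e. sum e T \<le> k}" by (rule finite_subset)
  thus ?thesis unfolding filtration_def by blast
qed

end

section \<open>Polynomial maps that commute with a tuple of forms\<close>

text \<open>The coefficients of \<open>\<Phi>\<close> lie in a finite-dimensional \<open>L\<close>-algebra, the span of \<open>G\<close>.\<close>

theorem commuting_coefficients:
  fixes \<Phi> \<Psi> :: "'n::finite \<Rightarrow> ('n, 'b::alg_closed_field) mpoly"
  assumes L: "is_subfield L" "infinite L" and hom: "\<And>j. homogeneous D (\<Psi> j)" and D: "D \<ge> 2"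
    and nv: "nonvanishing \<Psi>" and co: "\<And>j. \<Psi> j \<in> coeffs_in L"
    and comm: "mor_comp \<Phi> \<Psi> = mor_comp \<Psi> \<Phi>"
  obtains G where "finite G" "1 \<in> lspan L G"
    "\<And>a b. a \<in> lspan L G \<Longrightarrow> b \<in> lspan L G \<Longrightarrow> a * b \<in> lspan L G"
    "\<And>i m. Poly_Mapping.lookup (\<Phi> i) m \<in> lspan L G"
proof -
  obtain M H where M: "M \<ge> D" and H: "\<And>i j. homogeneous (M - D) (H i j)" "\<And>i j. H i j \<in> coeffs_in L"
    and eq: "\<And>i. var_mpoly i ^ M = (\<Sum>j\<in>UNIV. H i j * \<Psi> j)"
    by (rule nullstellensatz_over_subfield[OF L(1) hom nv co]) (rule that)
  define S where "S = {eval_mpoly id x (\<Phi> i) | x i. \<forall>j. x j \<in> L}"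
  have coS: "Poly_Mapping.lookup (\<Phi> i) m \<in> lspan L S" for i m
  proof (cases "m \<in> Poly_Mapping.keys (\<Phi> i)")
    case True
    show ?thesis
    proof (rule coefficients_in_subspace[OF L subsp_lspan finite_keys _ True])
      fix x :: "'n \<Rightarrow> 'b" assume "\<forall>i. x i \<in> L"
      hence "eval_mpoly id x (\<Phi> i) \<in> S" unfolding S_def by blast
      thus "(\<Sum>m\<in>Poly_Mapping.keys (\<Phi> i). Poly_Mapping.lookup (\<Phi> i) m * (\<Prod>i\<in>UNIV. x i ^ Poly_Mapping.lookup m i)) \<in> lspan L S"
        using lspan_superset[of S L] by (auto simp: eval_mpoly_def)
    qed
  next
    case False
    thus ?thesis using subspD(1)[OF subsp_lspan] by (simp add: in_keys_iff)
  qed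
  define C where "C = (\<Union>i. Poly_Mapping.lookup (\<Phi> i) ` Poly_Mapping.keys (\<Phi> i))"
  have "\<forall>c\<in>C. \<exists>T. finite T \<and> T \<subseteq> S \<and> c \<in> lspan L T"
    using coS unfolding C_def by (metis (no_types, lifting) UN_E imageE lspan_finite_support)
  then obtain f where f: "\<And>c. c \<in> C \<Longrightarrow> finite (f c) \<and> f c \<subseteq> S \<and> c \<in> lspan L (f c)" by metis
  define T where "T = (\<Union>c\<in>C. f c)"
  have T: "finite T" "T \<subseteq> S" using f by (auto simp: T_def C_def)
  have coT: "Poly_Mapping.lookup (\<Phi> i) m \<in> lspan L T" for i m
  proof (cases "m \<in> Poly_Mapping.keys (\<Phi> i)")
    case True
    hence c: "Poly_Mapping.lookup (\<Phi> i) m \<in> C" unfolding C_def by blast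
    hence "lspan L (f (Poly_Mapping.lookup (\<Phi> i) m)) \<subseteq> lspan L T"
      unfolding T_def by (intro lspan_mono) auto
    thus ?thesis using f[OF c] by blast
  next
    case False
    thus ?thesis using subspD(1)[OF subsp_lspan] by (simp add: in_keys_iff)
  qed
  let ?F = "filtration L T"
  note F1 = lspan_subset_filtration[OF L(1) T(1)]
  have S_F: "s \<in> ?F 1" if s: "s \<in> S" for s
  proof -
    obtain x i where x: "\<And>j. x j \<in> L" and sx: "s = eval_mpoly id x (\<Phi> i)" using s unfolding S_def by blast
    have "(\<Prod>i\<in>UNIV. x i ^ Poly_Mapping.lookup m i) * Poly_Mapping.lookup (\<Phi> i) m \<in> lspan L T" for m
      by (intro subspD(3)[OF subsp_lspan] coT is_subfield_prod is_subfield_power L x)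
    hence "s \<in> lspan L T"
      unfolding sx eval_mpoly_def by (intro subsp_sum[OF subsp_lspan]) (simp add: mult.commute)
    thus ?thesis using F1 by blast
  qed
  have int: "t ^ M \<in> ?F (M - 1)" if t: "t \<in> T" for t
  proof -
    obtain x i where x: "\<And>j. x j \<in> L" and tx: "t = eval_mpoly id x (\<Phi> i)" using t T(2) unfolding S_def by blast
    define w where "w = (\<lambda>j. eval_mpoly id x (\<Phi> j))"
    have w: "w j \<in> ?F 1" for j unfolding w_def using x by (intro S_F) (auto simp: S_def)
    have "eval_mpoly id w (\<Psi> j) \<in> ?F 1" for j
    proof -
      have "eval_mpoly id w (\<Psi> j) = eval_mpoly id x (mor_comp \<Psi> \<Phi> j)"
        by (simp add: eval_mor_comp w_def)
      also have "\<dots> = eval_mpoly id (\<lambda>k. eval_mpoly id x (\<Psi> k)) (\<Phi> j)"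
        by (simp only: comm[symmetric] eval_mor_comp[OF coeff_hom_id])
      also have "\<dots> \<in> S"
      proof -
        have "eval_mpoly id x (\<Psi> k) \<in> L" for k
          using co[of k] x by (intro eval_in_subfield[OF L(1)]) (auto simp: coeffs_in_def)
        thus ?thesis unfolding S_def by blast
      qed
      finally show ?thesis by (rule S_F)
    qed
    moreover have "eval_mpoly id w (H i j) \<in> ?F (M - D)" for j
      by (intro eval_homogeneous_in_filtration L T H w)
    ultimately have "eval_mpoly id w (H i j) * eval_mpoly id w (\<Psi> j) \<in> ?F (M - D + 1)" for j
      by (intro filtration_mult[OF L(1) T(1)])
    hence "(\<Sum>j\<in>UNIV. eval_mpoly id w (H i j) * eval_mpoly id w (\<Psi> j)) \<in> ?F (M - D + 1)"
      by (intro subsp_sum[OF subsp_filtration[OF L(1) T(1)]])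
    moreover have "t ^ M = eval_mpoly id w (var_mpoly i ^ M)"
      by (simp add: coeff_hom_power[OF coeff_hom_eval] tx w_def)
    hence "t ^ M = (\<Sum>j\<in>UNIV. eval_mpoly id w (H i j) * eval_mpoly id w (\<Psi> j))"
      by (simp add: eq eval_mpoly_sum eval_mpoly_mult)
    moreover have "?F (M - D + 1) \<subseteq> ?F (M - 1)"
      using M D by (intro filtration_mono[OF L(1) T(1)]) auto
    ultimately show ?thesis by auto
  qed
  define E where "E = card T * M"
  have stab: "?F k \<subseteq> ?F E" for k
    unfolding E_def using int M D by (intro filtration_stabilises[OF L(1) T(1)]) auto
  obtain G where G: "finite G" "?F E = lspan L G"
    using filtration_finitely_generated[OF L(1) T(1)] by blast
  show thesis
  proof (rule that[OF G(1)])
    show "1 \<in> lspan L G" using filtration_one[OF L(1) T(1), of E] G by simp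
    show "a * b \<in> lspan L G" if "a \<in> lspan L G" "b \<in> lspan L G" for a b
      using filtration_mult[OF L(1) T(1), of a E b E] that stab[of "E + E"] G by auto
    show "Poly_Mapping.lookup (\<Phi> i) m \<in> lspan L G" for i m
      using coT F1 stab[of 1] G by blast
  qed
qed

section \<open>Fields as ring records\<close>

lemma field_as_ring [simp]:
  "carrier ring_of_type_algebra = UNIV" "x \<otimes>\<^bsub>ring_of_type_algebra\<^esub> y = x * y"
  "x \<oplus>\<^bsub>ring_of_type_algebra\<^esub> y = x + y" "\<one>\<^bsub>ring_of_type_algebra\<^esub> = 1" "\<zero>\<^bsub>ring_of_type_algebra\<^esub> = 0"
  by (simp_all add: ring_of_type_algebra_def)

lemma field_as_ring_uminus: "\<ominus>\<^bsub>ring_of_type_algebra\<^esub> (x::'b::field) = - x"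
proof -
  interpret R: field "ring_of_type_algebra :: 'b ring" by rule
  show ?thesis by (rule R.minus_equality) auto
qed

lemma field_as_ring_power: "(x::'b::field) [^]\<^bsub>ring_of_type_algebra\<^esub> (n::nat) = x ^ n"
proof -
  interpret R: field "ring_of_type_algebra :: 'b ring" by rule
  show ?thesis by (induction n) (auto simp: mult.commute)
qed

lemma subfield_is_subfield:
  assumes "subfield (L :: 'b::field set) ring_of_type_algebra"
  shows "is_subfield L"
proof -
  interpret R: field "ring_of_type_algebra :: 'b ring" by rule
  note S = subringE[OF subfieldE(1)[OF assms]]
  have inv: "inverse a \<in> L" if a: "a \<in> L" for a
  proof (cases "a = 0")
    case True thus ?thesis using a by simp
  next
    case False
    hence "inv\<^bsub>ring_of_type_algebra\<^esub> a \<in> L" "a * inv\<^bsub>ring_of_type_algebra\<^esub> a = 1"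
      using R.subfield_m_inv(1,2)[OF assms, of a] a by auto
    thus ?thesis using inverse_unique by force
  qed
  show ?thesis
    unfolding is_subfield_def using S(2,3,5,6,7) inv by (auto simp: field_as_ring_uminus)
qed

lemma eval_list_eq_poly:
  fixes x :: "'b::field"
  shows "ring.eval ring_of_type_algebra xs x = poly (Poly (rev xs)) x"
proof -
  interpret R: field "ring_of_type_algebra :: 'b ring" by rule
  show ?thesis
    by (induction xs) (auto simp: Poly_append poly_monom field_as_ring_power mult.commute add.commute)
qed

lemma algebraic_if_poly_root:
  fixes x :: "'b::field"
  assumes "p \<noteq> 0" "\<And>i. Polynomial.coeff p i \<in> K" "poly p x = 0"
  shows "ring.algebraic ring_of_type_algebra K x"
proof -
  interpret R: field "ring_of_type_algebra :: 'b ring" by rule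
  have ne: "rev (coeffs p) \<noteq> []" using assms(1) by simp
  have "set (coeffs p) \<subseteq> K" using assms(2) by (auto simp: coeffs_def)
  moreover have "hd (rev (coeffs p)) \<noteq> 0"
    using assms(1) by (simp add: hd_rev last_coeffs_eq_coeff_degree)
  ultimately have "rev (coeffs p) \<in> carrier (univ_poly ring_of_type_algebra K)"
    using ne by (simp add: univ_poly_def polynomial_def)
  from R.algebraicI[OF this ne, of x] show ?thesis
    using assms(3) by (simp add: eval_list_eq_poly over_def)
qed

lemma lspan_eq_Span:
  assumes "subfield (K :: 'b::field set) ring_of_type_algebra"
  shows "ring.Span ring_of_type_algebra K xs = lspan K (set xs)"
proof -
  interpret R: field "ring_of_type_algebra :: 'b ring" by rule
  note K = is_subfieldD[OF subfield_is_subfield[OF assms]]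
  have "subalgebra K U ring_of_type_algebra \<longleftrightarrow> subsp K U" for U
  proof
    assume "subalgebra K U ring_of_type_algebra"
    then interpret U: subalgebra K U "ring_of_type_algebra :: 'b ring" .
    show "subsp K U"
      unfolding subsp_def using U.m_closed U.one_closed U.smult_closed by auto
  next
    assume U: "subsp K U"
    have neg: "- u \<in> U" if "u \<in> U" for u
      using subspD(3)[OF U K(5)[OF K(2)] that] by simp
    show "subalgebra K U ring_of_type_algebra"
    proof (intro subalgebra.intro subalgebra_axioms.intro)
      show "subgroup U (add_monoid (ring_of_type_algebra :: 'b ring))"
      proof (rule R.add.subgroupI)
        show "\<ominus>\<^bsub>ring_of_type_algebra\<^esub> a \<in> U" if "a \<in> U" for a
          using neg[OF that] by (simp add: field_as_ring_uminus)
      qed (use subspD[OF U] in auto)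
    qed (use subspD[OF U] in auto)
  qed
  thus ?thesis
    using R.Span_subalgebra_minimal[OF assms, of xs] by (simp add: lspan_def del: R.Span.simps)
qed

lemma algebraic_if_finitely_generated:
  fixes K :: "'b::field set"
  assumes K: "subfield K ring_of_type_algebra" and G: "finite G" "1 \<in> lspan K G"
    and mult: "\<And>a b. a \<in> lspan K G \<Longrightarrow> b \<in> lspan K G \<Longrightarrow> a * b \<in> lspan K G"
    and x: "x \<in> lspan K G"
  shows "ring.algebraic ring_of_type_algebra K x"
proof -
  interpret R: field "ring_of_type_algebra :: 'b ring" by rule
  obtain xs where xs: "set xs = G" using finite_list[OF G(1)] by blast
  have fin: "R.finite_dimension K (lspan K G)"
    using R.Span_finite_dimension[OF K, of xs] by (simp add: lspan_eq_Span[OF K] xs del: R.Span.simps)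
  note KD = is_subfieldD[OF subfield_is_subfield[OF K]]
  have "subring (lspan K G) ring_of_type_algebra"
  proof (rule R.subringI)
    fix a assume a: "a \<in> lspan K G"
    show "\<ominus>\<^bsub>ring_of_type_algebra\<^esub> a \<in> lspan K G"
      using subspD(3)[OF subsp_lspan KD(5)[OF KD(2)] a] by (simp add: field_as_ring_uminus)
  qed (use G mult subspD[OF subsp_lspan] in auto)
  from R.finite_dimension_imp_algebraic[OF K this fin x] show ?thesis by (simp add: over_def)
qed

section \<open>The subfield of algebraic elements\<close>

lemma subfield_algebraics:
  fixes K :: "'b::field set"
  assumes "subfield K ring_of_type_algebra"
  shows "subfield {x. ring.algebraic ring_of_type_algebra K x} ring_of_type_algebra"
proof -
  interpret R: field "ring_of_type_algebra :: 'b ring" by rule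
  show ?thesis using R.subfield_of_algebraics[OF assms] by (simp add: over_def)
qed

lemma algebraic_trans:
  fixes K :: "'b::field set"
  assumes K: "subfield K ring_of_type_algebra"
    and x: "ring.algebraic ring_of_type_algebra {y. ring.algebraic ring_of_type_algebra K y} x"
  shows "ring.algebraic ring_of_type_algebra K x"
proof -
  interpret R: field "ring_of_type_algebra :: 'b ring" by rule
  let ?A = "{y. R.algebraic K y}"
  obtain p where p: "p \<in> carrier (univ_poly ring_of_type_algebra ?A)" "p \<noteq> []" "R.eval p x = 0"
    using R.algebraicE[OF subfieldE(1)[OF subfield_algebraics[OF K]], of x] x
    by (auto simp: over_def)
  have pA: "set p \<subseteq> ?A" and lc: "hd p \<noteq> 0"
    using p(1,2) by (auto simp: univ_poly_def polynomial_def)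
  let ?E = "R.finite_extension K p"
  have alg: "\<And>y. y \<in> set p \<Longrightarrow> (R.algebraic over K) y" using pA by (auto simp: over_def)
  have E: "subfield ?E ring_of_type_algebra" "R.finite_dimension K ?E"
    using R.finite_extension_is_subfield[OF K _ alg] R.finite_extension_finite_dimension(1)[OF K _ alg]
    by (auto simp del: R.finite_extension.simps)
  have "set p \<subseteq> ?E"
    using R.finite_extension_mem[OF subfieldE(1)[OF K], of p] by (simp del: R.finite_extension.simps)
  hence "p \<in> carrier (univ_poly ring_of_type_algebra ?E)"
    using p(2) lc by (simp add: univ_poly_def polynomial_def del: R.finite_extension.simps)
  hence aE: "(R.algebraic over ?E) x" using R.algebraicI p(2,3) by (metis field_as_ring(5))
  let ?F = "R.simple_extension ?E x"
  have "R.finite_dimension ?E ?F"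
    using R.finite_dimension_simple_extension[OF E(1), of x] aE by (simp del: R.finite_extension.simps)
  hence "R.finite_dimension K ?F" using R.telescopic_base_dim(1)[OF K E] by blast
  moreover have "subring ?F ring_of_type_algebra"
    using R.simple_extension_is_subring[OF subfieldE(1)[OF E(1)], of x] by (simp del: R.finite_extension.simps)
  moreover have "x \<in> ?F"
    using R.simple_extension_mem[OF subfieldE(1)[OF E(1)], of x] by (simp del: R.finite_extension.simps)
  ultimately show ?thesis
    using R.finite_dimension_imp_algebraic[OF K] by (auto simp: over_def simp del: R.finite_extension.simps)
qed

text \<open>Euclid's argument: if there were only finitely many algebraic elements \<open>a\<close>, a root of
  \<open>\<Prod>(t - a) + 1\<close> would be a further one.\<close>

lemma infinite_algebraics:
  fixes K :: "'b::alg_closed_field set"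
  assumes K: "subfield K ring_of_type_algebra"
  shows "infinite {x. ring.algebraic ring_of_type_algebra K x}" (is "infinite ?A")
proof
  assume fin: "finite ?A"
  note A = subfield_is_subfield[OF subfield_algebraics[OF K]]
  have mult: "\<forall>i. Polynomial.coeff (p * q) i \<in> ?A"
    if "\<forall>i. Polynomial.coeff p i \<in> ?A" "\<forall>i. Polynomial.coeff q i \<in> ?A" for p q :: "'b poly"
    unfolding coeff_mult using that by (intro allI is_subfield_sum[OF A] is_subfieldD(4)[OF A]) auto
  have one: "\<forall>i. Polynomial.coeff (1 :: 'b poly) i \<in> ?A"
    using is_subfieldD(1,2)[OF A] by (simp add: coeff_1)
  have lin: "\<forall>i. Polynomial.coeff [:- a, 1:] i \<in> ?A" if "a \<in> ?A" for a
    using is_subfieldD(1,2)[OF A] is_subfieldD(5)[OF A that] by (simp add: coeff_pCons split: nat.split)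
  have prod_in: "\<forall>i. Polynomial.coeff (\<Prod>a\<in>B. [:- a, 1:]) i \<in> ?A" if "finite B" "B \<subseteq> ?A" for B
    using that
  proof (induction B rule: finite_induct)
    case empty show ?case using one by simp
  next
    case (insert b B)
    thus ?case unfolding prod.insert[OF insert.hyps(1,2)] by (intro mult lin) auto
  qed
  define q where "q = (\<Prod>a\<in>?A. [:- a, 1:]) + 1"
  have degq: "Polynomial.degree (\<Prod>a\<in>?A. [:- a, 1:]) = card ?A"
    by (subst degree_prod_eq_sum_degree) auto
  have "card ?A > 0" using is_subfieldD(1)[OF A] fin by (auto simp: card_gt_0_iff)
  hence "Polynomial.degree q > 0"
    unfolding q_def using degq by (subst degree_add_eq_left) auto
  then obtain x where x: "poly q x = 0" using alg_closed_imp_poly_has_root by blast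
  have "\<forall>i. Polynomial.coeff q i \<in> ?A"
    unfolding q_def coeff_add using prod_in[OF fin] one is_subfieldD(3)[OF A] by blast
  moreover have "q \<noteq> 0" using \<open>Polynomial.degree q > 0\<close> by auto
  ultimately have "ring.algebraic ring_of_type_algebra ?A x" using x by (intro algebraic_if_poly_root) auto
  hence "x \<in> ?A" using algebraic_trans[OF K] by blast
  hence "poly q x = 1" using fin by (simp add: q_def poly_prod prod_zero_iff)
  thus False using x by simp
qed

section \<open>Isotriviality of iterates\<close>

lemma subfield_to_ac_image:
  fixes k :: "'a::field set"
  assumes "subfield k ring_of_type_algebra"
  shows "subfield (to_ac ` k) ring_of_type_algebra"
proof -
  have "ring_hom_ring (ring_of_type_algebra :: 'a ring) (ring_of_type_algebra :: 'a alg_closure ring) to_ac"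
    by (intro ring_hom_ringI ring_from_type_algebra) auto
  from ring_hom_ring.img_is_subfield(2)[OF this assms] show ?thesis by simp
qed

lemma algebraic_over_base:
  fixes x :: "'a::field alg_closure"
  assumes "range to_ac \<subseteq> K"
  shows "ring.algebraic ring_of_type_algebra K x"
proof -
  obtain p :: "'a poly" where "p \<noteq> 0" "poly (map_poly to_ac p) x = 0"
    using alg_closure_algebraic[of x] by blast
  thus ?thesis using assms
    by (intro algebraic_if_poly_root[of "map_poly to_ac p"]) (auto simp: coeff_map_poly map_poly_eq_0_iff)
qed

lemma finite_ext_adjoin:
  fixes K :: "'a::field alg_closure set"
  assumes K: "finite_ext K" and B: "finite B"
  obtains K' where "finite_ext K'" "K \<subseteq> K'" "B \<subseteq> K'"
proof -
  interpret R: field "ring_of_type_algebra :: 'a alg_closure ring" by rule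
  obtain xs where xs: "set xs = B" using finite_list[OF B] by blast
  have K1: "subfield K ring_of_type_algebra" "range to_ac \<subseteq> K" "R.finite_dimension (range to_ac) K"
    using K unfolding finite_ext_def by auto
  have base: "subfield (range (to_ac :: 'a \<Rightarrow> _)) ring_of_type_algebra"
  proof -
    interpret Q: field "ring_of_type_algebra :: 'a ring" by rule
    show ?thesis using Q.carrier_is_subfield subfield_to_ac_image by auto
  qed
  have alg: "\<And>y. y \<in> set xs \<Longrightarrow> (R.algebraic over K) y"
    using algebraic_over_base[OF K1(2)] by (simp add: over_def)
  let ?E = "R.finite_extension K xs"
  have E: "subfield ?E ring_of_type_algebra" "R.finite_dimension K ?E"
    using R.finite_extension_is_subfield[OF K1(1) _ alg] R.finite_extension_finite_dimension(1)[OF K1(1) _ alg]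
    by (auto simp del: R.finite_extension.simps)
  have sub: "K \<subseteq> ?E" "B \<subseteq> ?E"
    using R.finite_extension_incl[of K xs] R.finite_extension_mem[OF subfieldE(1)[OF K1(1)], of xs] xs
    by (auto simp del: R.finite_extension.simps)
  have "R.finite_dimension (range to_ac) ?E"
    using R.telescopic_base_dim(1)[OF base K1(1,3) E(2)] .
  hence "finite_ext ?E" unfolding finite_ext_def using E(1) K1(2) sub(1) by blast
  thus thesis using that sub by blast
qed

lemma isotrivial_iterate:
  fixes \<phi> :: "'n::finite \<Rightarrow> ('n, 'a::field) mpoly"
  assumes k: "subfield k ring_of_type_algebra" and iso: "isotrivial k \<phi>"
  shows "isotrivial k (mor_iterate \<phi> r)"
proof -
  obtain K' and A :: "'a alg_closure^'n^'n" and G d c where K': "finite_ext K'" and A: "\<forall>i j. A $ i $ j \<in> K'" "invertible A"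
    and G: "proj_morphism (alg_closure_in k K') d G"
    and c: "c \<in> K'" "c \<noteq> 0" and eq: "\<forall>i. mor_conj A (base_change \<phi>) i = const_mpoly c * G i"
    using iso unfolding isotrivial_def same_morphism_def by blast
  have K's: "is_subfield K'" using K' subfield_is_subfield unfolding finite_ext_def by blast
  have "is_subfield {x. ring.algebraic ring_of_type_algebra (to_ac ` k) x}"
    by (intro subfield_is_subfield subfield_algebraics subfield_to_ac_image k)
  hence sub: "is_subfield (alg_closure_in k K')"
    using K's unfolding is_subfield_def alg_closure_in_def by auto
  have G': "\<And>i. homogeneous d (G i)" "\<And>i. G i \<in> coeffs_in (alg_closure_in k K')" "nonvanishing G"
    using G by (auto simp: proj_morphism_altdef coeffs_in_def)
  have "mor_conj A (base_change (mor_iterate \<phi> r)) = mor_iterate (scale_mor c G) r"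
  proof -
    have "mor_conj A (base_change \<phi>) = scale_mor c G" using eq by auto
    thus ?thesis by (simp add: base_change_iterate mor_conj_iterate[OF A(2)])
  qed
  hence "mor_conj A (base_change (mor_iterate \<phi> r)) = scale_mor (c ^ (\<Sum>i<r. d ^ i)) (mor_iterate G r)"
    by (simp only: mor_iterate_scale[OF G'(1)])
  hence "same_morphism K' (mor_conj A (base_change (mor_iterate \<phi> r))) (mor_iterate G r)"
    unfolding same_morphism_def using c
    by (intro bexI[of _ "c ^ (\<Sum>i<r. d ^ i)"] is_subfield_power[OF K's]) auto
  moreover have "proj_morphism (alg_closure_in k K') (d ^ r) (mor_iterate G r)"
    using homogeneous_iterate[OF G'(1)] coeffs_in_iterate[OF sub G'(2)] nonvanishing_iterate[OF G'(3)]
    by (auto simp: proj_morphism_altdef coeffs_in_def)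
  ultimately show ?thesis unfolding isotrivial_def using K' A by blast
qed

text \<open>The matrix \<open>A\<close> that conjugates the iterate into a morphism over the constants also works for
  \<open>\<phi>\<close> itself; only the finite extension has to be enlarged.\<close>

lemma isotrivial_if_iterate:
  fixes \<phi> :: "'n::finite \<Rightarrow> ('n, 'a::field) mpoly"
  assumes k: "subfield k ring_of_type_algebra"
    and \<phi>: "proj_morphism (range to_ac) d (base_change \<phi>)" and d: "d \<ge> 2" and r: "r \<ge> 1"
    and iso: "isotrivial k (mor_iterate \<phi> r)"
  shows "isotrivial k \<phi>"
proof -
  obtain K' and A :: "'a alg_closure^'n^'n" and G e c where K': "finite_ext K'" and A: "\<forall>i j. A $ i $ j \<in> K'" "invertible A"
    and G: "proj_morphism (alg_closure_in k K') e G"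
    and c: "c \<in> K'" "c \<noteq> 0"
    and eq: "\<forall>i. mor_conj A (base_change (mor_iterate \<phi> r)) i = const_mpoly c * G i"
    using iso unfolding isotrivial_def same_morphism_def by blast
  define F where "F = mor_conj A (base_change \<phi>)"
  have F: "\<And>i. homogeneous d (F i)" "nonvanishing F"
    using \<phi> homogeneous_mor_conj nonvanishing_mor_conj[OF A(2)] unfolding F_def proj_morphism_altdef by blast+
  have iter: "mor_iterate F r = scale_mor c G"
    using eq by (auto simp: F_def base_change_iterate mor_conj_iterate[OF A(2)])
  let ?N = "\<Sum>i<r. d ^ i"
  have "?N > 0" using r member_le_sum[of 0 "{..<r}" "\<lambda>i. d ^ i"] by auto
  \<comment> \<open>Rescaling \<open>F\<close> by \<open>s\<close> rescales its \<open>r\<close>-th iterate by \<open>s ^ ?N\<close>, which cancels \<open>c\<close>.\<close>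
  then obtain s where s: "s ^ ?N = inverse c" using nth_root_exists by blast
  have s0: "s \<noteq> 0" using s c(2) \<open>?N > 0\<close> by (metis nonzero_imp_inverse_nonzero power_0_left less_irrefl)
  define \<Phi> where "\<Phi> = scale_mor s F"
  have \<Phi>: "\<And>i. homogeneous d (\<Phi> i)" "nonvanishing \<Phi>"
    using F nonvanishing_scale[OF s0] by (auto simp: \<Phi>_def intro: homogeneous_const_mult)
  have \<Phi>G: "mor_iterate \<Phi> r = G"
    using c(2) by (auto simp: \<Phi>_def mor_iterate_scale[OF F(1)] iter s mult.assoc[symmetric] const_mpoly_mult[symmetric])
  let ?L = "{x. ring.algebraic ring_of_type_algebra (to_ac ` k) x}"
  have k': "subfield (to_ac ` k) ring_of_type_algebra" by (rule subfield_to_ac_image[OF k])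
  have L: "subfield ?L ring_of_type_algebra" by (rule subfield_algebraics[OF k'])
  have Ginf: "G i \<in> coeffs_in ?L" and Gn: "nonvanishing G" for i
    using G by (auto simp: proj_morphism_altdef coeffs_in_def alg_closure_in_def)
  have Gh: "homogeneous (d ^ r) (G i)" for i
    using homogeneous_iterate[where F = \<Phi> and r = r and i = i, OF \<Phi>(1)] by (simp add: \<Phi>G)
  have "d ^ 1 \<le> d ^ r" using d r by (intro power_increasing) auto
  hence "d ^ r \<ge> 2" using d by simp
  moreover have "mor_comp \<Phi> G = mor_comp G \<Phi>"
    using mor_iterate_commute[of \<Phi> r] by (simp add: \<Phi>G)
  ultimately obtain B where B: "finite B" "1 \<in> lspan ?L B"
    "\<And>a b. a \<in> lspan ?L B \<Longrightarrow> b \<in> lspan ?L B \<Longrightarrow> a * b \<in> lspan ?L B"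
    "\<And>i m. Poly_Mapping.lookup (\<Phi> i) m \<in> lspan ?L B"
    using commuting_coefficients[OF subfield_is_subfield[OF L] infinite_algebraics[OF k'] Gh _ Gn Ginf, of \<Phi>]
    by blast
  have \<Phi>L: "Poly_Mapping.lookup (\<Phi> i) m \<in> ?L" for i m
    using algebraic_trans[OF k' algebraic_if_finitely_generated[OF L B]] by blast
  define C where "C = insert s (\<Union>i. Poly_Mapping.lookup (\<Phi> i) ` Poly_Mapping.keys (\<Phi> i))"
  have "finite C" by (simp add: C_def)
  then obtain K'' where K'': "finite_ext K''" "K' \<subseteq> K''" "C \<subseteq> K''"
    using finite_ext_adjoin[OF K'] by blast
  have K''s: "is_subfield K''" using K''(1) subfield_is_subfield unfolding finite_ext_def by blast
  have "Poly_Mapping.lookup (\<Phi> i) m \<in> K''" for i m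
  proof (cases "m \<in> Poly_Mapping.keys (\<Phi> i)")
    case True thus ?thesis using K''(3) unfolding C_def by blast
  next
    case False thus ?thesis using is_subfieldD(1)[OF K''s] by (simp add: in_keys_iff)
  qed
  hence "proj_morphism (alg_closure_in k K'') d \<Phi>"
    using \<Phi> \<Phi>L by (auto simp: proj_morphism_altdef alg_closure_in_def)
  moreover have "same_morphism K'' F \<Phi>"
    unfolding same_morphism_def
  proof (intro bexI conjI allI)
    show "inverse s \<noteq> 0" using s0 by simp
    show "F i = const_mpoly (inverse s) * \<Phi> i" for i
      using s0 by (simp add: \<Phi>_def mult.assoc[symmetric] const_mpoly_mult[symmetric])
    show "inverse s \<in> K''" using K''(3) is_subfieldD(6)[OF K''s] by (auto simp: C_def)
  qed
  ultimately show ?thesis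
    unfolding isotrivial_def using K'' A unfolding F_def
    by (intro exI[of _ K''] exI[of _ A] exI[of _ \<Phi>] exI[of _ d]) blast
qed

theorem corollary16:
  fixes k :: "'a::field set" and C :: "'a set set"
    and \<phi> :: "'n::finite \<Rightarrow> ('n, 'a) mpoly" and N d r :: nat
  assumes "complete_nonsingular_curve k C"
    and "CARD('n) = N + 1" and "N \<ge> 1"
    and "proj_morphism (range to_ac) d (base_change \<phi>)" and "d \<ge> 2"
    and "r \<ge> 1"
  shows "isotrivial k \<phi> \<longleftrightarrow> isotrivial k (mor_iterate \<phi> r)"
proof -
  have "subfield k ring_of_type_algebra"
    using assms(1) by (simp add: complete_nonsingular_curve_def complete_model_def model_over_def)
  thus ?thesis using isotrivial_iterate isotrivial_if_iterate assms(4-6) by blast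
qed

end
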